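(* Assume the permutation missing data model for $(Y^{(1)},X^{(1)},R_1,R_2,Y,X)$ (defined in the context). Then $\psi=\mathbb{E}(Y^{(1)})$ is given by $$\psi=\mathbb{P}(R_1=1)\,\mathbb{E}(Y\mid R_1=1)+\mathbb{P}(R_1=0)\,\theta,$$ where $$\theta=\mathbb{E}(Y^{(1)}\mid R_1=0)=\mathbb{E}\left(\frac{\mathbb{E}\{Y/\zeta(Y)\mid R_1=1,R_2=1,X\}}{\mathbb{E}\{1/\zeta(Y)\mid R_1=1,R_2=1,X\}}\,\middle|\,R_1=0,R_2=1\right)$$ for $\zeta(Y)=\mathbb{P}[R_2=1\mid R_1=1,Y]$.
   Context: Full data: $Y^{(1)}$ is a real-valued random variable, $X^{(1)}$ is a random variable (possibly vector-valued), and $R_1,R_2\in\{0,1\}$ are missingness indicators. Observed data are $(R_1,R_2,Y,X)$: $Y=Y^{(1)}$ if $R_1=1$ and $Y=$ "?" (a fixed missing symbol) if $R_1=0$; $X=X^{(1)}$ if $R_2=1$ and $X=$ "?" if $R_2=0$. Permutation missingness model: the joint law of these variables factorizes according to the directed acyclic graph with edges $Y^{(1)}\to X^{(1)}$, $X^{(1)}\to R_1$, $R_1\to R_2$, $Y\to R_2$, together with the deterministic edges $Y^{(1)}\to Y$, $R_1\to Y$, $X^{(1)}\to X$, $R_2\to X$. Under this model, $R_1$ is conditionally independent of $Y^{(1)}$ given $X^{(1)}$, and $R_2$ is conditionally independent of $(Y^{(1)},X^{(1)})$ given $(Y,R_1)$.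
   Formalization: Adds that Y^(1) is integrable and the positivity conditions P(R_1=1|X^(1))>0 and P(R_2=1|R_1,Y)>0 almost surely; without positivity the formula can be false (if ζ(Y)=0 with positive probability) or its conditional expectations undefined. *)

theory Defs
  imports "HOL-Probability.Probability"
begin

section \<open>Possibly missing values\<close>

text \<open>
  The missing symbol ``?'' is \<^term>\<open>None\<close> and an observed value \<open>v\<close> is \<open>Some v\<close>. The
  \<open>\<sigma>\<close>-algebra below is the one of the disjoint union of \<open>N\<close> and a point.
\<close>

definition option_space :: "'b measure \<Rightarrow> 'b option measure" where
  "option_space N =
     sigma (insert None (Some ` space N)) (insert {None} {Some ` A | A. A \<in> sets N})"

definition observe :: "bool \<Rightarrow> 'b \<Rightarrow> 'b option" where
  "observe r v = (if r then Some v else None)"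

lemma option_space_subset:
  "insert {None} {Some ` A | A. A \<in> sets N} \<subseteq> Pow (insert None (Some ` space N))"
  using sets.sets_into_space by fastforce

lemma space_option_space [simp]: "space (option_space N) = insert None (Some ` space N)"
  unfolding option_space_def by (rule space_measure_of[OF option_space_subset])

lemma measurable_Some_option_space [measurable]: "Some \<in> N \<rightarrow>\<^sub>M option_space N"
  unfolding option_space_def
proof (rule measurable_measure_of[OF option_space_subset])
  fix A assume A: "A \<in> insert {None} {Some ` A | A. A \<in> sets N}"
  show "Some -` A \<inter> space N \<in> sets N"
  proof (cases "A = {None}")
    case True
    then have "Some -` A \<inter> space N = {}" by auto
    then show ?thesis by simp
  next
    case False
    then obtain B where B: "A = Some ` B" "B \<in> sets N" using A by auto
    have "Some -` A \<inter> space N = B"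
      using B sets.sets_into_space[OF B(2)] by auto
    then show ?thesis using B by simp
  qed
qed auto

lemma measurable_None_option_space [measurable]: "(\<lambda>_. None) \<in> N' \<rightarrow>\<^sub>M option_space N"
  by (rule measurable_const) simp

lemma measurable_the_option_space [measurable]:
  "the \<in> option_space borel \<rightarrow>\<^sub>M (borel :: real measure)"
proof (rule measurableI)
  fix A :: "real set" assume A: "A \<in> sets borel"
  have None: "{None} \<in> sets (option_space borel :: real option measure)"
    unfolding option_space_def sets_measure_of[OF option_space_subset]
    by (rule sigma_sets.Basic) simp
  have Some: "Some ` A \<in> sets (option_space borel)"
    unfolding option_space_def sets_measure_of[OF option_space_subset]
    by (rule sigma_sets.Basic) (use A in blast)
  have "the -` A \<inter> space (option_space borel) =
      (if the None \<in> A then {None} else {}) \<union> Some ` A" by auto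
  also have "\<dots> \<in> sets (option_space borel)"
  proof (rule sets.Un[OF _ Some])
    show "(if the None \<in> A then {None} else {}) \<in> sets (option_space borel :: real option measure)"
      by (simp add: None)
  qed
  finally show "the -` A \<inter> space (option_space borel) \<in> sets (option_space borel)" .
qed simp

lemma measurable_observe [measurable]:
  assumes [measurable]: "r \<in> M \<rightarrow>\<^sub>M count_space UNIV" "f \<in> M \<rightarrow>\<^sub>M N"
  shows "(\<lambda>\<omega>. observe (r \<omega>) (f \<omega>)) \<in> M \<rightarrow>\<^sub>M option_space N"
  unfolding observe_def by measurable

section \<open>The permutation missing data model\<close>

abbreviation bool_space :: "bool measure" where
  "bool_space \<equiv> count_space UNIV"

definition joint_space ::
  "'x measure \<Rightarrow> (real \<times> 'x \<times> bool \<times> bool \<times> real option \<times> 'x option) measure" where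
  "joint_space S = borel \<Otimes>\<^sub>M S \<Otimes>\<^sub>M bool_space \<Otimes>\<^sub>M bool_space
                     \<Otimes>\<^sub>M option_space borel \<Otimes>\<^sub>M option_space S"

text \<open>
  The law of \<open>(Y1, X1, R1, R2, Y, X)\<close> that is generated along the directed acyclic graph
  with edges \<open>Y1 \<rightarrow> X1\<close>, \<open>X1 \<rightarrow> R1\<close>, \<open>R1 \<rightarrow> R2\<close>, \<open>Y \<rightarrow> R2\<close> and the deterministic edges
  \<open>Y1 \<rightarrow> Y\<close>, \<open>R1 \<rightarrow> Y\<close>, \<open>X1 \<rightarrow> X\<close>, \<open>R2 \<rightarrow> X\<close>: each variable is drawn from a Markov kernel
  (a law, for the root) that depends only on the parents of the variable. The factors of
  \<open>Y\<close> and \<open>X\<close> are the Dirac kernels at \<^term>\<open>observe r1 y1\<close> and \<^term>\<open>observe r2 x1\<close>.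
\<close>

definition permutation_dag_law ::
  "'x measure \<Rightarrow> real measure \<Rightarrow> (real \<Rightarrow> 'x measure) \<Rightarrow> ('x \<Rightarrow> bool measure)
    \<Rightarrow> (bool \<times> real option \<Rightarrow> bool measure)
    \<Rightarrow> (real \<times> 'x \<times> bool \<times> bool \<times> real option \<times> 'x option) measure" where
  "permutation_dag_law S KY1 KX1 KR1 KR2 =
     do {
       y1 \<leftarrow> KY1;
       x1 \<leftarrow> KX1 y1;
       r1 \<leftarrow> KR1 x1;
       y \<leftarrow> return (option_space borel) (observe r1 y1);
       r2 \<leftarrow> KR2 (r1, y);
       x \<leftarrow> return (option_space S) (observe r2 x1);
       return (joint_space S) (y1, x1, r1, r2, y, x)
     }"

locale permutation_model = prob_space M
  for M :: "'a measure" +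
  fixes S :: "'x measure"
    and Y1 :: "'a \<Rightarrow> real" and X1 :: "'a \<Rightarrow> 'x"
    and R1 R2 :: "'a \<Rightarrow> bool"
    and Y :: "'a \<Rightarrow> real option" and X :: "'a \<Rightarrow> 'x option"
  assumes measurable_Y1 [measurable]: "Y1 \<in> M \<rightarrow>\<^sub>M borel"
    and measurable_X1 [measurable]: "X1 \<in> M \<rightarrow>\<^sub>M S"
    and measurable_R1 [measurable]: "R1 \<in> M \<rightarrow>\<^sub>M bool_space"
    and measurable_R2 [measurable]: "R2 \<in> M \<rightarrow>\<^sub>M bool_space"
    and Y_observed: "\<And>\<omega>. \<omega> \<in> space M \<Longrightarrow> Y \<omega> = observe (R1 \<omega>) (Y1 \<omega>)"
    and X_observed: "\<And>\<omega>. \<omega> \<in> space M \<Longrightarrow> X \<omega> = observe (R2 \<omega>) (X1 \<omega>)"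
    and factorization:
      "\<exists>KY1 KX1 KR1 KR2.
         KY1 \<in> space (prob_algebra borel) \<and>
         KX1 \<in> borel \<rightarrow>\<^sub>M prob_algebra S \<and>
         KR1 \<in> S \<rightarrow>\<^sub>M prob_algebra bool_space \<and>
         KR2 \<in> bool_space \<Otimes>\<^sub>M option_space borel \<rightarrow>\<^sub>M prob_algebra bool_space \<and>
         distr M (joint_space S) (\<lambda>\<omega>. (Y1 \<omega>, X1 \<omega>, R1 \<omega>, R2 \<omega>, Y \<omega>, X \<omega>)) =
           permutation_dag_law S KY1 KX1 KR1 KR2"
begin

lemma measurable_Y [measurable]: "Y \<in> M \<rightarrow>\<^sub>M option_space borel"
proof -
  have "(\<lambda>\<omega>. observe (R1 \<omega>) (Y1 \<omega>)) \<in> M \<rightarrow>\<^sub>M option_space borel" by measurable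
  moreover have "Y \<in> M \<rightarrow>\<^sub>M T \<longleftrightarrow> (\<lambda>\<omega>. observe (R1 \<omega>) (Y1 \<omega>)) \<in> M \<rightarrow>\<^sub>M T" for T
    by (rule measurable_cong) (rule Y_observed)
  ultimately show ?thesis by blast
qed

lemma measurable_X [measurable]: "X \<in> M \<rightarrow>\<^sub>M option_space S"
proof -
  have "(\<lambda>\<omega>. observe (R2 \<omega>) (X1 \<omega>)) \<in> M \<rightarrow>\<^sub>M option_space S" by measurable
  moreover have "X \<in> M \<rightarrow>\<^sub>M T \<longleftrightarrow> (\<lambda>\<omega>. observe (R2 \<omega>) (X1 \<omega>)) \<in> M \<rightarrow>\<^sub>M T" for T
    by (rule measurable_cong) (rule X_observed)
  ultimately show ?thesis by blast
qed

lemma measurable_joint: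
  "(\<lambda>\<omega>. (Y1 \<omega>, X1 \<omega>, R1 \<omega>, R2 \<omega>, Y \<omega>, X \<omega>)) \<in> M \<rightarrow>\<^sub>M joint_space S"
  unfolding joint_space_def by measurable

end

section \<open>Conditioning\<close>

text \<open>The conditional law given the event \<open>P\<close>; it is the zero measure if \<open>P\<close> is a null event.\<close>

abbreviation given :: "'a measure \<Rightarrow> ('a \<Rightarrow> bool) \<Rightarrow> 'a measure" where
  "given M P \<equiv> uniform_measure M {\<omega> \<in> space M. P \<omega>}"

definition sigma_gen :: "'a measure \<Rightarrow> ('a \<Rightarrow> 'v) \<Rightarrow> 'v measure \<Rightarrow> 'a measure" where
  "sigma_gen M V T = vimage_algebra (space M) V T"

text \<open>
  \<open>g\<close> is a version of the regression function \<open>v \<mapsto> E(f | V = v)\<close> under \<open>N\<close>, that is,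
  \<open>g(V)\<close> is a version of \<open>E(f | V)\<close>. The function itself is needed, and not only the random
  variable \<open>E(f | V)\<close>, because it is evaluated at \<open>V\<close> under a conditional law other than \<open>N\<close>.
\<close>

definition regression_version ::
  "'a measure \<Rightarrow> ('a \<Rightarrow> 'v) \<Rightarrow> 'v measure \<Rightarrow> ('a \<Rightarrow> real) \<Rightarrow> ('v \<Rightarrow> real) \<Rightarrow> bool" where
  "regression_version N V T f g \<longleftrightarrow>
     g \<in> T \<rightarrow>\<^sub>M borel \<and> (AE \<omega> in N. real_cond_exp N (sigma_gen N V T) f \<omega> = g (V \<omega>))"

text \<open>
  Positivity: each missingness indicator equals one with positive conditional probability
  given its parents in the graph.
\<close>

definition positivity ::
  "'a measure \<Rightarrow> 'x measure \<Rightarrow> ('a \<Rightarrow> 'x) \<Rightarrow> ('a \<Rightarrow> bool) \<Rightarrow> ('a \<Rightarrow> bool) \<Rightarrow> ('a \<Rightarrow> real option)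
    \<Rightarrow> bool" where
  "positivity M S X1 R1 R2 Y \<longleftrightarrow>
     (AE \<omega> in M. real_cond_exp M (sigma_gen M X1 S) (\<lambda>\<omega>. of_bool (R1 \<omega>)) \<omega> > 0) \<and>
     (AE \<omega> in M. real_cond_exp M
         (sigma_gen M (\<lambda>\<omega>. (R1 \<omega>, Y \<omega>)) (bool_space \<Otimes>\<^sub>M option_space borel))
         (\<lambda>\<omega>. of_bool (R2 \<omega>)) \<omega> > 0)"

end

theory Submission
  imports Defs
begin

text \<open>
  Write \<open>p(X1) = P(R1 = 1 | X1)\<close>. Since \<open>R2\<close> depends on \<open>(R1, Y)\<close> only, dividing by \<open>\<zeta>(Y)\<close> on the
  complete cases undoes the selection by \<open>R2\<close>, and then \<open>R1\<close> may be replaced by \<open>p(X1)\<close>: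
  \<open>E(R1 R2 u(Y1, X1) / \<zeta>(Y)) = E(p(X1) u(Y1, X1))\<close>. Hence, for every measurable \<open>B\<close>, the integrals of
  \<open>den(X)\<close> and \<open>num(X)\<close> over the complete cases with \<open>X1 \<in> B\<close> are \<open>E(p(X1); X1 \<in> B)\<close> and
  \<open>E(p(X1) Y1; X1 \<in> B)\<close>. As \<open>p(X1) > 0\<close>, this forces \<open>den > 0\<close> and \<open>num/den = E(Y1 | X1)\<close> almost surely.
  Given \<open>R1 = 0\<close>, \<open>Y\<close> is constant, so that \<open>R2\<close> is independent of \<open>(Y1, X1)\<close>, and \<open>Y1\<close> is independent
  of \<open>R1\<close> given \<open>X1\<close>; so the mean of \<open>E(Y1 | X1)\<close> over \<open>R1 = 0, R2 = 1\<close> is \<open>E(Y1 | R1 = 0)\<close>.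
\<close>

section \<open>Conditional laws and regression functions\<close>

lemma integrable_of_bool_mult:
  fixes f :: "'a \<Rightarrow> real"
  assumes [measurable]: "Measurable.pred M P" and "integrable M f"
  shows "integrable M (\<lambda>\<omega>. of_bool (P \<omega>) * f \<omega>)"
  by (rule Bochner_Integration.integrable_bound[OF assms(2)]) (use assms(2) in auto)

lemma (in prob_space) prob_eq_integral:
  assumes [measurable]: "Measurable.pred M P"
  shows "\<P>(\<omega> in M. P \<omega>) = (\<integral>\<omega>. of_bool (P \<omega>) \<partial>M)"
proof -
  have "(\<integral>\<omega>. of_bool (P \<omega>) \<partial>M) = (\<integral>\<omega>. indicat_real {\<omega> \<in> space M. P \<omega>} \<omega> \<partial>M)"
    by (intro Bochner_Integration.integral_cong) (auto simp: indicator_def)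
  then show ?thesis by (simp add: Int_absorb2 subset_eq)
qed

text \<open>A real-valued density makes the Bochner integral rules for \<open>density\<close>
  applicable. The identity survives a null event: off the event both quotients are 0, by the
  conventions for 0/0, and the event itself does not matter almost everywhere.\<close>

lemma (in prob_space) given_eq_density:
  assumes [measurable]: "Measurable.pred M P"
  shows "given M P = density M (\<lambda>\<omega>. ennreal (of_bool (P \<omega>) / \<P>(\<omega> in M. P \<omega>)))"
proof -
  have "AE \<omega> in M. indicator {\<omega> \<in> space M. P \<omega>} \<omega> / emeasure M {\<omega> \<in> space M. P \<omega>} =
      ennreal (of_bool (P \<omega>) / \<P>(\<omega> in M. P \<omega>))"
  proof (cases "\<P>(\<omega> in M. P \<omega>) = 0")
    case True
    then have "AE \<omega> in M. \<not> P \<omega>"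
      by (subst (asm) prob_Collect_eq_0) auto
    then show ?thesis
      by eventually_elim simp
  next
    case False
    then have "\<P>(\<omega> in M. P \<omega>) > 0"
      by (simp add: zero_less_measure_iff)
    then show ?thesis
      by (intro AE_I2) (auto simp: emeasure_eq_measure divide_ennreal indicator_def
          simp flip: ennreal_1)
  qed
  then show ?thesis
    unfolding uniform_measure_def by (intro density_cong) measurable
qed

lemma (in prob_space) integral_given:
  fixes f :: "'a \<Rightarrow> real"
  assumes [measurable]: "Measurable.pred M P" "f \<in> borel_measurable M"
  shows "(\<integral>\<omega>. f \<omega> \<partial>given M P) = (\<integral>\<omega>. of_bool (P \<omega>) * f \<omega> \<partial>M) / \<P>(\<omega> in M. P \<omega>)"
  unfolding given_eq_density[OF assms(1)]
  by (subst integral_density) auto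

lemma (in prob_space) integrable_given:
  fixes f :: "'a \<Rightarrow> real"
  assumes [measurable]: "Measurable.pred M P" "integrable M (\<lambda>\<omega>. of_bool (P \<omega>) * f \<omega>)"
    and [measurable]: "f \<in> borel_measurable M"
  shows "integrable (given M P) f"
  unfolding given_eq_density[OF assms(1)]
  using assms(2) by (subst integrable_density) auto

lemma (in prob_space) integrable_of_bool_mult_given:
  fixes f :: "'a \<Rightarrow> real"
  assumes [measurable]: "Measurable.pred M P" and pos: "\<P>(\<omega> in M. P \<omega>) \<noteq> 0"
    and int: "integrable (given M P) f"
  shows "integrable M (\<lambda>\<omega>. of_bool (P \<omega>) * f \<omega>)"
proof -
  have [measurable]: "f \<in> borel_measurable M"
    using borel_measurable_integrable[OF int] by (simp add: uniform_measure_def)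
  have "integrable M (\<lambda>\<omega>. of_bool (P \<omega>) / \<P>(\<omega> in M. P \<omega>) * f \<omega>)"
    using int unfolding given_eq_density[OF assms(1)]
    by (subst (asm) integrable_density) auto
  from integrable_mult_right[OF this, of "\<P>(\<omega> in M. P \<omega>)"] pos show ?thesis
    by simp
qed

lemma (in prob_space) finite_measure_given:
  assumes [measurable]: "Measurable.pred M P"
  shows "finite_measure (given M P)"
proof (rule finite_measureI)
  let ?A = "{\<omega> \<in> space M. P \<omega>}"
  have "emeasure (given M P) (space M) = emeasure M ?A / emeasure M ?A"
    by (simp add: Int_absorb2 subset_eq)
  also have "\<dots> \<noteq> \<infinity>"
    \<comment> \<open>The total mass is 1, or 0/0 = 0 when the event is null. Finiteness is all that
      conditional expectations under the conditioned law require.\<close>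
    by (cases "emeasure M ?A = 0") (simp_all add: ennreal_divide_self less_top[symmetric])
  finally show "emeasure (given M P) (space (given M P)) \<noteq> \<infinity>"
    by (simp add: uniform_measure_def)
qed

lemma measurable_given: "measurable (given M P) T = measurable M T"
  by (intro measurable_cong_sets) (auto simp: uniform_measure_def)

lemma (in prob_space) AE_given_iff:
  assumes [measurable]: "Measurable.pred M P" and pos: "\<P>(\<omega> in M. P \<omega>) \<noteq> 0"
  shows "(AE \<omega> in given M P. Q \<omega>) \<longleftrightarrow> (AE \<omega> in M. P \<omega> \<longrightarrow> Q \<omega>)"
proof -
  have "(AE \<omega> in given M P. Q \<omega>) \<longleftrightarrow> (AE \<omega> in M. \<omega> \<in> {\<omega> \<in> space M. P \<omega>} \<longrightarrow> Q \<omega>)"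
    using pos by (intro AE_uniform_measure) (auto simp: emeasure_eq_measure)
  also have "\<dots> \<longleftrightarrow> (AE \<omega> in M. P \<omega> \<longrightarrow> Q \<omega>)"
    by (intro AE_cong) auto
  finally show ?thesis .
qed

section \<open>Generated sigma-algebras and versions of regression functions\<close>

lemma measurable_sigma_gen:
  assumes "V \<in> M \<rightarrow>\<^sub>M T"
  shows "V \<in> sigma_gen M V T \<rightarrow>\<^sub>M T"
  using assms unfolding sigma_gen_def by (intro measurable_vimage_algebra1) (auto dest: measurable_space)

lemma sets_sigma_gen:
  assumes "V \<in> M \<rightarrow>\<^sub>M T"
  shows "sets (sigma_gen M V T) = {V -` B \<inter> space M |B. B \<in> sets T}"
  using assms unfolding sigma_gen_def by (intro sets_vimage_algebra2) (auto dest: measurable_space)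

lemma subalgebra_sigma_gen:
  assumes "V \<in> M \<rightarrow>\<^sub>M T"
  shows "subalgebra M (sigma_gen M V T)"
  unfolding subalgebra_def sets_sigma_gen[OF assms]
  using assms by (auto simp: sigma_gen_def)

lemma (in finite_measure) sigma_finite_subalgebra_sigma_gen:
  assumes "V \<in> M \<rightarrow>\<^sub>M T"
  shows "sigma_finite_subalgebra M (sigma_gen M V T)"
  by (intro finite_measure_subalgebra_is_sigma_finite)
    (simp add: finite_measure_subalgebra_def finite_measure_subalgebra_axioms_def
      finite_measure_axioms subalgebra_sigma_gen assms)

text \<open>Every set of the sigma-algebra generated by \<open>V\<close> is a preimage under
  \<open>V\<close>, so the defining property of conditional expectation need only be tested on
  indicators of \<open>V\<close>. The setting is a finite measure so that the rule also serves for
  the conditioned laws.\<close>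

lemma (in finite_measure) real_cond_exp_sigma_genI:
  assumes V[measurable]: "V \<in> M \<rightarrow>\<^sub>M T"
    and [measurable]: "g \<in> borel_measurable T"
    and int: "integrable M f" "integrable M (\<lambda>\<omega>. g (V \<omega>))"
    and eq: "\<And>B. B \<in> sets T \<Longrightarrow>
      (\<integral>\<omega>. f \<omega> * indicator B (V \<omega>) \<partial>M) = (\<integral>\<omega>. g (V \<omega>) * indicator B (V \<omega>) \<partial>M)"
  shows "AE \<omega> in M. real_cond_exp M (sigma_gen M V T) f \<omega> = g (V \<omega>)"
proof -
  interpret sigma_finite_subalgebra M "sigma_gen M V T"
    by (rule sigma_finite_subalgebra_sigma_gen[OF V])
  have [measurable]: "V \<in> sigma_gen M V T \<rightarrow>\<^sub>M T"
    by (rule measurable_sigma_gen[OF V])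
  show ?thesis
  proof (rule real_cond_exp_charact[OF _ int])
    fix A assume "A \<in> sets (sigma_gen M V T)"
    then obtain B where B: "A = V -` B \<inter> space M" "B \<in> sets T"
      unfolding sets_sigma_gen[OF V] by auto
    have set: "(\<integral>\<omega>\<in>A. h \<omega> \<partial>M) = (\<integral>\<omega>. h \<omega> * indicator B (V \<omega>) \<partial>M)" for h :: "'a \<Rightarrow> real"
      unfolding set_lebesgue_integral_def B(1)
      by (intro Bochner_Integration.integral_cong) (auto simp: indicator_def)
    show "(\<integral>\<omega>\<in>A. f \<omega> \<partial>M) = (\<integral>\<omega>\<in>A. g (V \<omega>) \<partial>M)"
      unfolding set by (rule eq[OF B(2)])
  qed measurable
qed

text \<open>Passes back from a version to integral identities. Integrability of
  \<open>g (V \<omega>)\<close> is inherited from the conditional expectation, with which it agrees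
  almost everywhere.\<close>

lemma (in finite_measure) regression_versionD:
  assumes V[measurable]: "V \<in> M \<rightarrow>\<^sub>M T"
    and int: "integrable M f"
    and reg: "regression_version M V T f g"
  shows "integrable M (\<lambda>\<omega>. g (V \<omega>))"
    and "B \<in> sets T \<Longrightarrow>
      (\<integral>\<omega>. g (V \<omega>) * indicator B (V \<omega>) \<partial>M) = (\<integral>\<omega>. f \<omega> * indicator B (V \<omega>) \<partial>M)"
proof -
  interpret sigma_finite_subalgebra M "sigma_gen M V T"
    by (rule sigma_finite_subalgebra_sigma_gen[OF V])
  have [measurable]: "g \<in> borel_measurable T"
    and AE: "AE \<omega> in M. real_cond_exp M (sigma_gen M V T) f \<omega> = g (V \<omega>)"
    using reg by (auto simp: regression_version_def)
  show "integrable M (\<lambda>\<omega>. g (V \<omega>))"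
    using real_cond_exp_int(1)[OF int] AE by (subst (asm) integrable_cong_AE) auto
  assume B[measurable]: "B \<in> sets T"
  then have A: "V -` B \<inter> space M \<in> sets (sigma_gen M V T)"
    unfolding sets_sigma_gen[OF V] by auto
  have set: "(\<integral>\<omega>\<in>V -` B \<inter> space M. h \<omega> \<partial>M) = (\<integral>\<omega>. h \<omega> * indicator B (V \<omega>) \<partial>M)" for h :: "'a \<Rightarrow> real"
    unfolding set_lebesgue_integral_def
    by (intro Bochner_Integration.integral_cong) (auto simp: indicator_def)
  have "(\<integral>\<omega>. g (V \<omega>) * indicator B (V \<omega>) \<partial>M) =
      (\<integral>\<omega>. real_cond_exp M (sigma_gen M V T) f \<omega> * indicator B (V \<omega>) \<partial>M)"
    using AE by (intro integral_cong_AE) auto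
  then show "(\<integral>\<omega>. g (V \<omega>) * indicator B (V \<omega>) \<partial>M) = (\<integral>\<omega>. f \<omega> * indicator B (V \<omega>) \<partial>M)"
    using real_cond_exp_intA[OF int A] unfolding set by simp
qed

section \<open>Weights that induce the same image law\<close>

lemma
  fixes w :: "'a \<Rightarrow> real" and g :: "'v \<Rightarrow> real"
  assumes [measurable]: "w \<in> borel_measurable M" "w' \<in> borel_measurable M" "V \<in> M \<rightarrow>\<^sub>M T"
    "g \<in> borel_measurable T"
    and nonneg: "AE \<omega> in M. 0 \<le> w \<omega>" "AE \<omega> in M. 0 \<le> w' \<omega>"
    and eq: "distr (density M w) T V = distr (density M w') T V"
  shows integrable_distr_density_iff:
      "integrable M (\<lambda>\<omega>. w \<omega> * g (V \<omega>)) \<longleftrightarrow> integrable M (\<lambda>\<omega>. w' \<omega> * g (V \<omega>))"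
    and integral_distr_density_eq:
      "(\<integral>\<omega>. w \<omega> * g (V \<omega>) \<partial>M) = (\<integral>\<omega>. w' \<omega> * g (V \<omega>) \<partial>M)"
proof -
  \<comment> \<open>Each weighted integral is an integral of \<open>g\<close> under the image law of
    the weighted measure. Equal image laws therefore make the weights interchangeable against any
    function of \<open>V\<close>.\<close>
  have "integrable (distr (density M u) T V) g \<longleftrightarrow> integrable M (\<lambda>\<omega>. u \<omega> * g (V \<omega>))"
    and "(\<integral>v. g v \<partial>distr (density M u) T V) = (\<integral>\<omega>. u \<omega> * g (V \<omega>) \<partial>M)"
    if [measurable]: "u \<in> borel_measurable M" and "AE \<omega> in M. 0 \<le> u \<omega>" for u :: "'a \<Rightarrow> real"
    using that(2)
    by (simp_all add: integrable_distr_eq integral_distr integrable_density integral_density)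
  note * = this
  show "integrable M (\<lambda>\<omega>. w \<omega> * g (V \<omega>)) \<longleftrightarrow> integrable M (\<lambda>\<omega>. w' \<omega> * g (V \<omega>))"
    and "(\<integral>\<omega>. w \<omega> * g (V \<omega>) \<partial>M) = (\<integral>\<omega>. w' \<omega> * g (V \<omega>) \<partial>M)"
    using *[of w] *[of w'] nonneg eq by simp_all
qed

lemma distr_density_eqI:
  assumes [measurable]: "w \<in> borel_measurable M" "w' \<in> borel_measurable M" "V \<in> M \<rightarrow>\<^sub>M T"
    and eq: "\<And>B. B \<in> sets T \<Longrightarrow>
      (\<integral>\<^sup>+\<omega>. w \<omega> * indicator B (V \<omega>) \<partial>M) = (\<integral>\<^sup>+\<omega>. w' \<omega> * indicator B (V \<omega>) \<partial>M)"
  shows "distr (density M w) T V = distr (density M w') T V"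
proof (rule measure_eqI)
  fix B assume "B \<in> sets (distr (density M w) T V)"
  then have [measurable]: "B \<in> sets T" by simp
  have *: "emeasure (distr (density M u) T V) B = (\<integral>\<^sup>+\<omega>. u \<omega> * indicator B (V \<omega>) \<partial>M)"
    if [measurable]: "u \<in> borel_measurable M" for u
    by (subst emeasure_distr, simp, simp, subst emeasure_density)
      (auto intro!: nn_integral_cong simp: indicator_def)
  show "emeasure (distr (density M w) T V) B = emeasure (distr (density M w') T V) B"
    by (simp add: * eq)
qed simp

text \<open>Integrability and almost sure nonnegativity turn the nonnegative integrals of the
  previous criterion into Bochner integrals. The sign may fail on a null set, as it can for the
  weight built later from \<open>den\<close>.\<close>

lemma distr_density_eq_integralI:
  fixes w w' :: "'a \<Rightarrow> real"
  assumes int: "integrable M w" "integrable M w'"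
    and nonneg: "AE \<omega> in M. 0 \<le> w \<omega>" "AE \<omega> in M. 0 \<le> w' \<omega>"
    and V[measurable]: "V \<in> M \<rightarrow>\<^sub>M T"
    and eq: "\<And>B. B \<in> sets T \<Longrightarrow>
      (\<integral>\<omega>. w \<omega> * indicator B (V \<omega>) \<partial>M) = (\<integral>\<omega>. w' \<omega> * indicator B (V \<omega>) \<partial>M)"
  shows "distr (density M w) T V = distr (density M w') T V"
proof (rule distr_density_eqI)
  fix B assume B[measurable]: "B \<in> sets T"
  have *: "(\<integral>\<^sup>+\<omega>. ennreal (u \<omega>) * indicator B (V \<omega>) \<partial>M) = ennreal (\<integral>\<omega>. u \<omega> * indicator B (V \<omega>) \<partial>M)"
    if u: "integrable M u" "AE \<omega> in M. 0 \<le> u \<omega>" for u :: "'a \<Rightarrow> real"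
  proof -
    have "integrable M (\<lambda>\<omega>. u \<omega> * indicator B (V \<omega>))"
      by (rule Bochner_Integration.integrable_bound[OF u(1)])
        (use u(1) in \<open>auto simp: indicator_def\<close>)
    moreover have "AE \<omega> in M. 0 \<le> u \<omega> * indicator B (V \<omega>)"
      using u(2) by eventually_elim simp
    ultimately have "(\<integral>\<^sup>+\<omega>. ennreal (u \<omega> * indicator B (V \<omega>)) \<partial>M) =
        ennreal (\<integral>\<omega>. u \<omega> * indicator B (V \<omega>) \<partial>M)"
      by (rule nn_integral_eq_integral)
    moreover have "ennreal (u \<omega>) * indicator B (V \<omega>) = ennreal (u \<omega> * indicator B (V \<omega>))" for \<omega>
      by (simp add: indicator_def)
    ultimately show ?thesis by simp
  qed
  show "(\<integral>\<^sup>+\<omega>. ennreal (w \<omega>) * indicator B (V \<omega>) \<partial>M) =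
      (\<integral>\<^sup>+\<omega>. ennreal (w' \<omega>) * indicator B (V \<omega>) \<partial>M)"
    by (simp add: * int nonneg eq[OF B])
qed (use int in auto)

lemma sets_option_space_image_Some:
  assumes "A \<in> sets N"
  shows "Some ` A \<in> sets (option_space N)"
  unfolding option_space_def sets_measure_of[OF option_space_subset]
  using assms by (intro sigma_sets.Basic) blast

section \<open>Integration along the graph\<close>

lemma nn_integral_bool_prob:
  assumes "N \<in> space (prob_algebra bool_space)"
  shows "(\<integral>\<^sup>+r. ennreal (of_bool r) * c \<partial>N) = ennreal (measure N {True}) * c"
    and "emeasure N (space N) = 1"
proof -
  have sets[measurable_cong]: "sets N = sets bool_space" and "prob_space N"
    using assms by (auto simp: space_prob_algebra)
  then interpret prob_space N by simp
  have "(\<integral>\<^sup>+r. ennreal (of_bool r) * c \<partial>N) = (\<integral>\<^sup>+r. c * indicator {True} r \<partial>N)"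
    by (intro nn_integral_cong) (auto simp: indicator_def)
  also have "\<dots> = c * emeasure N {True}"
    by (intro nn_integral_cmult_indicator) (simp add: sets)
  finally show "(\<integral>\<^sup>+r. ennreal (of_bool r) * c \<partial>N) = ennreal (measure N {True}) * c"
    by (simp add: emeasure_eq_measure mult.commute)
  show "emeasure N (space N) = 1"
    by (simp add: emeasure_space_1)
qed

text \<open>
  \<open>p\<close> and \<open>z\<close> stand for \<open>P(R1 = 1 | X1)\<close> and \<open>P(R2 = 1 | R1, Y)\<close>. The equations \<open>distr_R1\<close> and
  \<open>distr_R2\<close> carry the conditional independences: an indicator may be exchanged for its conditional
  probability under an integral against any function of \<open>(Y1, X1)\<close>, respectively \<open>(Y1, X1, R1)\<close>.
\<close>

locale missingness_probabilities = permutation_model +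
  fixes p :: "'b \<Rightarrow> real" and z :: "bool \<times> real option \<Rightarrow> real"
  assumes measurable_p [measurable]: "p \<in> borel_measurable S"
    and measurable_z [measurable]: "z \<in> borel_measurable (bool_space \<Otimes>\<^sub>M option_space borel)"
    and p_nonneg: "\<And>x. 0 \<le> p x" and p_le_1: "\<And>x. x \<in> space S \<Longrightarrow> p x \<le> 1"
    and z_nonneg: "\<And>v. 0 \<le> z v" and z_le_1: "\<And>v. z v \<le> 1"
    and distr_R1: "distr (density M (\<lambda>\<omega>. ennreal (of_bool (R1 \<omega>)))) (borel \<Otimes>\<^sub>M S) (\<lambda>\<omega>. (Y1 \<omega>, X1 \<omega>)) =
      distr (density M (\<lambda>\<omega>. ennreal (p (X1 \<omega>)))) (borel \<Otimes>\<^sub>M S) (\<lambda>\<omega>. (Y1 \<omega>, X1 \<omega>))"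
    and distr_R2: "distr (density M (\<lambda>\<omega>. ennreal (of_bool (R2 \<omega>)))) (borel \<Otimes>\<^sub>M S \<Otimes>\<^sub>M bool_space)
        (\<lambda>\<omega>. (Y1 \<omega>, X1 \<omega>, R1 \<omega>)) =
      distr (density M (\<lambda>\<omega>. ennreal (z (R1 \<omega>, Y \<omega>)))) (borel \<Otimes>\<^sub>M S \<Otimes>\<^sub>M bool_space)
        (\<lambda>\<omega>. (Y1 \<omega>, X1 \<omega>, R1 \<omega>))"
    and positive: "positivity M S X1 R1 R2 Y"

section \<open>Iterated kernel integrals of the factorized law\<close>

context permutation_model
begin

text \<open>Integrating against the law of the graph unfolds one kernel at a time, and the Dirac
  kernels of \<open>Y\<close> and \<open>X\<close> collapse to evaluation. Nonnegative integrands
  avoid all integrability conditions, and \<open>G\<close> omits \<open>Y\<close> and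
  \<open>X\<close> because they are functions of the other variables.\<close>

lemma nn_integral_factorization:
  obtains KY1 KX1 KR1 KR2
  where "KY1 \<in> space (prob_algebra borel)"
    and "KX1 \<in> borel \<rightarrow>\<^sub>M prob_algebra S"
    and "KR1 \<in> S \<rightarrow>\<^sub>M prob_algebra bool_space"
    and "KR2 \<in> bool_space \<Otimes>\<^sub>M option_space borel \<rightarrow>\<^sub>M prob_algebra bool_space"
    and "\<And>G. (\<lambda>(y1, x1, r1, r2). G y1 x1 r1 r2) \<in>
        borel_measurable (borel \<Otimes>\<^sub>M S \<Otimes>\<^sub>M bool_space \<Otimes>\<^sub>M bool_space) \<Longrightarrow>
      (\<integral>\<^sup>+\<omega>. G (Y1 \<omega>) (X1 \<omega>) (R1 \<omega>) (R2 \<omega>) \<partial>M) =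
      (\<integral>\<^sup>+y1. \<integral>\<^sup>+x1. \<integral>\<^sup>+r1. \<integral>\<^sup>+r2. G y1 x1 r1 r2 \<partial>KR2 (r1, observe r1 y1) \<partial>KR1 x1 \<partial>KX1 y1 \<partial>KY1)"
proof -
  obtain KY1 KX1 KR1 KR2
    where KY1: "KY1 \<in> space (prob_algebra borel)"
    and KX1: "KX1 \<in> borel \<rightarrow>\<^sub>M prob_algebra S"
    and KR1: "KR1 \<in> S \<rightarrow>\<^sub>M prob_algebra bool_space"
    and KR2: "KR2 \<in> bool_space \<Otimes>\<^sub>M option_space borel \<rightarrow>\<^sub>M prob_algebra bool_space"
    and law: "distr M (joint_space S) (\<lambda>\<omega>. (Y1 \<omega>, X1 \<omega>, R1 \<omega>, R2 \<omega>, Y \<omega>, X \<omega>)) =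
           permutation_dag_law S KY1 KX1 KR1 KR2"
    using factorization by blast
  note [measurable] = KX1[THEN measurable_prob_algebraD] KR1[THEN measurable_prob_algebraD]
    KR2[THEN measurable_prob_algebraD]
  have sets_KY1[measurable_cong]: "sets KY1 = sets borel"
    using KY1 by (simp add: space_prob_algebra)
  have "(\<integral>\<^sup>+\<omega>. G (Y1 \<omega>) (X1 \<omega>) (R1 \<omega>) (R2 \<omega>) \<partial>M) =
      (\<integral>\<^sup>+y1. \<integral>\<^sup>+x1. \<integral>\<^sup>+r1. \<integral>\<^sup>+r2. G y1 x1 r1 r2 \<partial>KR2 (r1, observe r1 y1) \<partial>KR1 x1 \<partial>KX1 y1 \<partial>KY1)"
    if G: "(\<lambda>(y1, x1, r1, r2). G y1 x1 r1 r2) \<in>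
        borel_measurable (borel \<Otimes>\<^sub>M S \<Otimes>\<^sub>M bool_space \<Otimes>\<^sub>M bool_space)" for G
  proof -
    define F :: "real \<times> 'x \<times> bool \<times> bool \<times> real option \<times> 'x option \<Rightarrow> ennreal"
      where "F = (\<lambda>v. (\<lambda>(y1, x1, r1, r2). G y1 x1 r1 r2) (fst v, fst (snd v), fst (snd (snd v)), fst (snd (snd (snd v)))))"
    have F[measurable]: "F \<in> borel_measurable (joint_space S)"
      unfolding F_def joint_space_def using G by measurable
    \<comment> \<open>\<open>k6\<close> down to \<open>k2\<close> are the successive tails of the
      monadic law, innermost first. The facts \<open>m6\<close> to \<open>m2\<close> make them
      measurable jointly in all the variables drawn before, as needed for measurability of the
      enclosing bind.\<close>
    define k6 where "k6 y1 x1 r1 y r2 = return (option_space S) (observe r2 x1) \<bind>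
        (\<lambda>x. return (joint_space S) (y1, x1, r1, r2, y, x))" for y1 x1 r1 y r2
    define k5 where "k5 y1 x1 r1 y = KR2 (r1, y) \<bind> k6 y1 x1 r1 y" for y1 x1 r1 y
    define k4 where "k4 y1 x1 r1 = return (option_space borel) (observe r1 y1) \<bind> k5 y1 x1 r1" for y1 x1 r1
    define k3 where "k3 y1 x1 = KR1 x1 \<bind> k4 y1 x1" for y1 x1
    define k2 where "k2 y1 = KX1 y1 \<bind> k3 y1" for y1
    have m6: "(\<lambda>(y1, x1, r1, y, r2). k6 y1 x1 r1 y r2) \<in>
      borel \<Otimes>\<^sub>M S \<Otimes>\<^sub>M bool_space \<Otimes>\<^sub>M option_space borel \<Otimes>\<^sub>M bool_space \<rightarrow>\<^sub>M subprob_algebra (joint_space S)"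
      unfolding k6_def joint_space_def by measurable
    have m5: "(\<lambda>(y1, x1, r1, y). k5 y1 x1 r1 y) \<in>
      borel \<Otimes>\<^sub>M S \<Otimes>\<^sub>M bool_space \<Otimes>\<^sub>M option_space borel \<rightarrow>\<^sub>M subprob_algebra (joint_space S)"
      unfolding k5_def split_beta
    proof (rule measurable_bind)
      show "(\<lambda>v. KR2 (fst (snd (snd v)), snd (snd (snd v)))) \<in>
          borel \<Otimes>\<^sub>M S \<Otimes>\<^sub>M bool_space \<Otimes>\<^sub>M option_space borel \<rightarrow>\<^sub>M subprob_algebra bool_space"
        by (rule measurable_compose[OF _ KR2[THEN measurable_prob_algebraD]]) measurable
      show "(\<lambda>v. k6 (fst (fst v)) (fst (snd (fst v))) (fst (snd (snd (fst v))))
            (snd (snd (snd (fst v)))) (snd v)) \<in>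
          (borel \<Otimes>\<^sub>M S \<Otimes>\<^sub>M bool_space \<Otimes>\<^sub>M option_space borel) \<Otimes>\<^sub>M bool_space \<rightarrow>\<^sub>M
          subprob_algebra (joint_space S)"
        \<comment> \<open>\<open>measurable_bind\<close> appends the new variable to the right of
          the whole earlier tuple, so the coordinates are reassociated to the nesting used in
          \<open>m6\<close>.\<close>
        using measurable_compose[OF _ m6, of "\<lambda>v. (fst (fst v), fst (snd (fst v)),
            fst (snd (snd (fst v))), snd (snd (snd (fst v))), snd v)"] by simp
    qed
    have m4: "(\<lambda>(y1, x1, r1). k4 y1 x1 r1) \<in>
      borel \<Otimes>\<^sub>M S \<Otimes>\<^sub>M bool_space \<rightarrow>\<^sub>M subprob_algebra (joint_space S)"
      unfolding k4_def split_beta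
    proof (rule measurable_bind)
      show "(\<lambda>v. return (option_space borel) (observe (snd (snd v)) (fst v))) \<in>
          borel \<Otimes>\<^sub>M S \<Otimes>\<^sub>M bool_space \<rightarrow>\<^sub>M subprob_algebra (option_space borel)"
        by (rule measurable_compose[OF _ return_measurable], rule measurable_observe) measurable
      show "(\<lambda>v. k5 (fst (fst v)) (fst (snd (fst v))) (snd (snd (fst v))) (snd v)) \<in>
          (borel \<Otimes>\<^sub>M S \<Otimes>\<^sub>M bool_space) \<Otimes>\<^sub>M option_space borel \<rightarrow>\<^sub>M
          subprob_algebra (joint_space S)"
        using measurable_compose[OF _ m5, of "\<lambda>v. (fst (fst v), fst (snd (fst v)),
            snd (snd (fst v)), snd v)"] by simp
    qed
    have m3: "(\<lambda>(y1, x1). k3 y1 x1) \<in> borel \<Otimes>\<^sub>M S \<rightarrow>\<^sub>M subprob_algebra (joint_space S)"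
      unfolding k3_def split_beta
    proof (rule measurable_bind)
      show "(\<lambda>v. KR1 (snd v)) \<in> borel \<Otimes>\<^sub>M S \<rightarrow>\<^sub>M subprob_algebra bool_space"
        by measurable
      show "(\<lambda>v. k4 (fst (fst v)) (snd (fst v)) (snd v)) \<in>
          (borel \<Otimes>\<^sub>M S) \<Otimes>\<^sub>M bool_space \<rightarrow>\<^sub>M subprob_algebra (joint_space S)"
        using measurable_compose[OF _ m4, of "\<lambda>v. (fst (fst v), snd (fst v), snd v)"] by simp
    qed
    have m2: "k2 \<in> borel \<rightarrow>\<^sub>M subprob_algebra (joint_space S)"
      unfolding k2_def using m3 by measurable
    have in_space: "y \<in> space (option_space borel)" for y :: "real option"
      by (cases y) auto
    have F_eq: "F (y1, x1, r1, r2, y, x) = G y1 x1 r1 r2" for y1 x1 r1 r2 y x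
      by (simp add: F_def)
    \<comment> \<open>The facts \<open>i6\<close> to \<open>i2\<close> evaluate the tails from the
      inside outwards. The condition that \<open>x1\<close> lies in \<open>space S\<close> is
      carried along because the Dirac kernel of \<open>X\<close> and the kernel \<open>KR1\<close>
      are controlled only there; it is discharged in \<open>i2\<close>, where \<open>x1\<close> is
      integrated over that space.\<close>
    have i6: "(\<integral>\<^sup>+v. F v \<partial>k6 y1 x1 r1 y r2) = G y1 x1 r1 r2"
      if "x1 \<in> space S" for y1 x1 r1 y r2
    proof -
      have [measurable]: "x1 \<in> space S" "y \<in> space (option_space borel)" by fact (rule in_space)
      have "(\<lambda>x. (y1, x1, r1, r2, y, x)) \<in> option_space S \<rightarrow>\<^sub>M joint_space S"
        unfolding joint_space_def by measurable
      note m = measurable_compose[OF this return_measurable]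
      have sp: "observe r2 x1 \<in> space (option_space S)"
        using that by (simp add: observe_def)
      have "(\<integral>\<^sup>+v. F v \<partial>k6 y1 x1 r1 y r2) =
          (\<integral>\<^sup>+v. F v \<partial>return (joint_space S) (y1, x1, r1, r2, y, observe r2 x1))"
        unfolding k6_def by (simp add: bind_return[OF m sp])
      also have "\<dots> = G y1 x1 r1 r2"
      proof (subst nn_integral_return[OF _ F])
        show "(y1, x1, r1, r2, y, observe r2 x1) \<in> space (joint_space S)"
          using that sp in_space[of y] by (auto simp: joint_space_def space_pair_measure)
      qed (rule F_eq)
      finally show ?thesis .
    qed
    have sets_kernel: "sets (KX1 y1) = sets S" "x1 \<in> space S \<Longrightarrow> sets (KR1 x1) = sets bool_space"
      "sets (KR2 (r1, y)) = sets bool_space" for y1 x1 r1 y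
      using measurable_space[OF KX1, of y1] measurable_space[OF KR1, of x1]
        measurable_space[OF KR2, of "(r1, y)"] in_space[of y]
      by (auto simp: space_prob_algebra space_pair_measure)
    have i5: "(\<integral>\<^sup>+v. F v \<partial>k5 y1 x1 r1 y) = (\<integral>\<^sup>+r2. G y1 x1 r1 r2 \<partial>KR2 (r1, y))"
      if x1[measurable]: "x1 \<in> space S" for y1 x1 r1 y
    proof -
      have [measurable]: "y \<in> space (option_space borel)" by (rule in_space)
      have "(\<lambda>r2. (y1, x1, r1, y, r2)) \<in> bool_space \<rightarrow>\<^sub>M borel \<Otimes>\<^sub>M S \<Otimes>\<^sub>M bool_space \<Otimes>\<^sub>M option_space borel \<Otimes>\<^sub>M bool_space"
        by measurable
      from measurable_compose[OF this m6]
      have "k6 y1 x1 r1 y \<in> bool_space \<rightarrow>\<^sub>M subprob_algebra (joint_space S)"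
        by (simp del: measurable_count_space_eq1)
      then have "k6 y1 x1 r1 y \<in> KR2 (r1, y) \<rightarrow>\<^sub>M subprob_algebra (joint_space S)"
        using measurable_cong_sets[OF sets_kernel(3) refl] by blast
      from nn_integral_bind[OF F this] show ?thesis
        unfolding k5_def by (simp add: i6[OF x1])
    qed
    have i4: "(\<integral>\<^sup>+v. F v \<partial>k4 y1 x1 r1) = (\<integral>\<^sup>+r2. G y1 x1 r1 r2 \<partial>KR2 (r1, observe r1 y1))"
      if x1[measurable]: "x1 \<in> space S" for y1 x1 r1
    proof -
      have "(\<lambda>y. (y1, x1, r1, y)) \<in> option_space borel \<rightarrow>\<^sub>M borel \<Otimes>\<^sub>M S \<Otimes>\<^sub>M bool_space \<Otimes>\<^sub>M option_space borel"
        by measurable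
      from measurable_compose[OF this m5]
      have "k5 y1 x1 r1 \<in> option_space borel \<rightarrow>\<^sub>M subprob_algebra (joint_space S)"
        by (simp del: measurable_count_space_eq1)
      from bind_return[OF this in_space] show ?thesis
        unfolding k4_def by (simp add: i5[OF x1])
    qed
    have i3: "(\<integral>\<^sup>+v. F v \<partial>k3 y1 x1) =
        (\<integral>\<^sup>+r1. \<integral>\<^sup>+r2. G y1 x1 r1 r2 \<partial>KR2 (r1, observe r1 y1) \<partial>KR1 x1)"
      if x1[measurable]: "x1 \<in> space S" for y1 x1
    proof -
      have "(\<lambda>r1. (y1, x1, r1)) \<in> bool_space \<rightarrow>\<^sub>M borel \<Otimes>\<^sub>M S \<Otimes>\<^sub>M bool_space"
        by measurable
      from measurable_compose[OF this m4]
      have "k4 y1 x1 \<in> bool_space \<rightarrow>\<^sub>M subprob_algebra (joint_space S)"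
        by (simp del: measurable_count_space_eq1)
      then have "k4 y1 x1 \<in> KR1 x1 \<rightarrow>\<^sub>M subprob_algebra (joint_space S)"
        using measurable_cong_sets[OF sets_kernel(2)[OF x1] refl] by blast
      from nn_integral_bind[OF F this] show ?thesis
        unfolding k3_def by (simp add: i4[OF x1])
    qed
    have i2: "(\<integral>\<^sup>+v. F v \<partial>k2 y1) =
        (\<integral>\<^sup>+x1. \<integral>\<^sup>+r1. \<integral>\<^sup>+r2. G y1 x1 r1 r2 \<partial>KR2 (r1, observe r1 y1) \<partial>KR1 x1 \<partial>KX1 y1)" for y1
    proof -
      have "(\<lambda>x1. (y1, x1)) \<in> S \<rightarrow>\<^sub>M borel \<Otimes>\<^sub>M S"
        by measurable
      from measurable_compose[OF this m3]
      have "k3 y1 \<in> S \<rightarrow>\<^sub>M subprob_algebra (joint_space S)"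
        by (simp del: measurable_count_space_eq1)
      then have "k3 y1 \<in> KX1 y1 \<rightarrow>\<^sub>M subprob_algebra (joint_space S)"
        using measurable_cong_sets[OF sets_kernel(1) refl] by blast
      from nn_integral_bind[OF F this] show ?thesis
        unfolding k2_def
        by (simp add: i3 sets_eq_imp_space_eq[OF sets_kernel(1)] cong: nn_integral_cong_simp)
    qed
    have k2: "k2 \<in> KY1 \<rightarrow>\<^sub>M subprob_algebra (joint_space S)"
      using m2 measurable_cong_sets[OF sets_KY1 refl] by blast
    have "(\<integral>\<^sup>+\<omega>. G (Y1 \<omega>) (X1 \<omega>) (R1 \<omega>) (R2 \<omega>) \<partial>M) =
        (\<integral>\<^sup>+v. F v \<partial>distr M (joint_space S) (\<lambda>\<omega>. (Y1 \<omega>, X1 \<omega>, R1 \<omega>, R2 \<omega>, Y \<omega>, X \<omega>)))"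
      by (simp add: nn_integral_distr[OF measurable_joint] F F_eq)
    also have "distr M (joint_space S) (\<lambda>\<omega>. (Y1 \<omega>, X1 \<omega>, R1 \<omega>, R2 \<omega>, Y \<omega>, X \<omega>)) = KY1 \<bind> k2"
      by (simp add: law permutation_dag_law_def k2_def[abs_def] k3_def[abs_def] k4_def[abs_def]
          k5_def[abs_def] k6_def[abs_def])
    also have "(\<integral>\<^sup>+v. F v \<partial>(KY1 \<bind> k2)) = (\<integral>\<^sup>+y1. \<integral>\<^sup>+v. F v \<partial>k2 y1 \<partial>KY1)"
      by (rule nn_integral_bind[OF F k2])
    finally show ?thesis
      unfolding i2 .
  qed
  then show ?thesis
    using that KY1 KX1 KR1 KR2 by blast
qed

text \<open>The kernels of the two indicators supply the probabilities. The conditional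
  independences hold because \<open>KR1\<close> does not see \<open>y1\<close>, and
  \<open>KR2\<close> sees \<open>y1\<close> and \<open>x1\<close> only through \<open>r1\<close> and
  the observed value.\<close>

lemma missingness_probabilities_exist:
  assumes "positivity M S X1 R1 R2 Y"
  obtains p z where "missingness_probabilities M S Y1 X1 R1 R2 Y X p z"
proof -
  obtain KY1 KX1 KR1 KR2
    where KY1: "KY1 \<in> space (prob_algebra borel)"
    and KX1: "KX1 \<in> borel \<rightarrow>\<^sub>M prob_algebra S"
    and KR1[measurable]: "KR1 \<in> S \<rightarrow>\<^sub>M prob_algebra bool_space"
    and KR2[measurable]: "KR2 \<in> bool_space \<Otimes>\<^sub>M option_space borel \<rightarrow>\<^sub>M prob_algebra bool_space"
    and law: "\<And>G. (\<lambda>(y1, x1, r1, r2). G y1 x1 r1 r2) \<in>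
        borel_measurable (borel \<Otimes>\<^sub>M S \<Otimes>\<^sub>M bool_space \<Otimes>\<^sub>M bool_space) \<Longrightarrow>
      (\<integral>\<^sup>+\<omega>. G (Y1 \<omega>) (X1 \<omega>) (R1 \<omega>) (R2 \<omega>) \<partial>M) =
      (\<integral>\<^sup>+y1. \<integral>\<^sup>+x1. \<integral>\<^sup>+r1. \<integral>\<^sup>+r2. G y1 x1 r1 r2 \<partial>KR2 (r1, observe r1 y1) \<partial>KR1 x1 \<partial>KX1 y1 \<partial>KY1)"
    using nn_integral_factorization by blast
  \<comment> \<open>Taking kernel masses instead of conditional expectations gives functions defined
    pointwise, with bounds that hold without exceptional null sets.\<close>
  define p where "p x = measure (KR1 x) {True}" for x
  define z where "z v = (measure (KR2 v) {True})" for v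
  have p[measurable]: "p \<in> borel_measurable S"
    unfolding p_def by measurable
  have z[measurable]: "z \<in> borel_measurable (bool_space \<Otimes>\<^sub>M option_space borel)"
    unfolding z_def by measurable
  have "(r, y) \<in> space (bool_space \<Otimes>\<^sub>M option_space borel)" for r and y :: "real option"
    by (cases y) (auto simp: space_pair_measure)
  then have KR2_space: "KR2 v \<in> space (prob_algebra bool_space)" for v
    using measurable_space[OF KR2] by (cases v) blast
  have KR1_space: "KR1 x \<in> space (prob_algebra bool_space)" if "x \<in> space S" for x
    using measurable_space[OF KR1 that] .
  have KX1_space: "space (KX1 y) = space S" for y
    using measurable_space[OF KX1, of y] by (auto simp: space_prob_algebra dest: sets_eq_imp_space_eq)
  note simps = nn_integral_bool_prob[OF KR1_space] nn_integral_bool_prob[OF KR2_space] KX1_space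
    p_def[symmetric] z_def[symmetric]
  have le1: "p x \<le> 1" if "x \<in> space S" for x
    using KR1_space[OF that] unfolding p_def
    by (auto simp: space_prob_algebra intro: prob_space.prob_le_1)
  have z_le1: "z v \<le> 1" for v
    using KR2_space[of v] unfolding z_def
    by (auto simp: space_prob_algebra intro: prob_space.prob_le_1)
  have d1: "distr (density M (\<lambda>\<omega>. ennreal (of_bool (R1 \<omega>)))) (borel \<Otimes>\<^sub>M S) (\<lambda>\<omega>. (Y1 \<omega>, X1 \<omega>)) =
      distr (density M (\<lambda>\<omega>. ennreal (p (X1 \<omega>)))) (borel \<Otimes>\<^sub>M S) (\<lambda>\<omega>. (Y1 \<omega>, X1 \<omega>))"
  proof (rule distr_density_eqI)
    fix B assume [measurable]: "B \<in> sets (borel \<Otimes>\<^sub>M S :: (real \<times> 'x) measure)"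
    \<comment> \<open>The kernel of \<open>R2\<close> has mass 1 and integrates out; integrating
      \<open>r1\<close> then leaves \<open>p x1\<close>. The weight \<open>p (X1 \<omega>)\<close>
      leads to the same double integral, since now both indicator kernels integrate out.\<close>
    have "(\<integral>\<^sup>+\<omega>. ennreal (of_bool (R1 \<omega>)) * indicator B (Y1 \<omega>, X1 \<omega>) \<partial>M) =
        (\<integral>\<^sup>+y1. \<integral>\<^sup>+x1. ennreal (p x1) * indicator B (y1, x1) \<partial>KX1 y1 \<partial>KY1)"
      by (subst law[of "\<lambda>y1 x1 r1 r2. ennreal (of_bool r1) * indicator B (y1, x1)"])
        (auto simp: simps cong: nn_integral_cong_simp)
    also have "\<dots> = (\<integral>\<^sup>+\<omega>. ennreal (p (X1 \<omega>)) * indicator B (Y1 \<omega>, X1 \<omega>) \<partial>M)"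
      by (subst law[of "\<lambda>y1 x1 r1 r2. ennreal (p x1) * indicator B (y1, x1)"])
        (auto simp: simps cong: nn_integral_cong_simp)
    finally show "(\<integral>\<^sup>+\<omega>. ennreal (of_bool (R1 \<omega>)) * indicator B (Y1 \<omega>, X1 \<omega>) \<partial>M) =
        (\<integral>\<^sup>+\<omega>. ennreal (p (X1 \<omega>)) * indicator B (Y1 \<omega>, X1 \<omega>) \<partial>M)" .
  qed measurable
  have d2: "distr (density M (\<lambda>\<omega>. ennreal (of_bool (R2 \<omega>)))) (borel \<Otimes>\<^sub>M S \<Otimes>\<^sub>M bool_space)
        (\<lambda>\<omega>. (Y1 \<omega>, X1 \<omega>, R1 \<omega>)) =
      distr (density M (\<lambda>\<omega>. ennreal (z (R1 \<omega>, Y \<omega>)))) (borel \<Otimes>\<^sub>M S \<Otimes>\<^sub>M bool_space)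
        (\<lambda>\<omega>. (Y1 \<omega>, X1 \<omega>, R1 \<omega>))"
  proof (rule distr_density_eqI)
    fix B assume [measurable]: "B \<in> sets (borel \<Otimes>\<^sub>M S \<Otimes>\<^sub>M bool_space :: (real \<times> 'x \<times> bool) measure)"
    \<comment> \<open>Only \<open>r2\<close> is integrated out here: \<open>r1\<close> occurs both
      in \<open>z\<close> and in the test set.\<close>
    have "(\<integral>\<^sup>+\<omega>. ennreal (of_bool (R2 \<omega>)) * indicator B (Y1 \<omega>, X1 \<omega>, R1 \<omega>) \<partial>M) =
        (\<integral>\<^sup>+y1. \<integral>\<^sup>+x1. \<integral>\<^sup>+r1. ennreal (z (r1, observe r1 y1)) * indicator B (y1, x1, r1) \<partial>KR1 x1 \<partial>KX1 y1 \<partial>KY1)"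
      by (subst law[of "\<lambda>y1 x1 r1 r2. ennreal (of_bool r2) * indicator B (y1, x1, r1)"])
        (auto simp: simps cong: nn_integral_cong_simp)
    also have "\<dots> = (\<integral>\<^sup>+\<omega>. ennreal (z (R1 \<omega>, observe (R1 \<omega>) (Y1 \<omega>))) * indicator B (Y1 \<omega>, X1 \<omega>, R1 \<omega>) \<partial>M)"
      by (subst law[of "\<lambda>y1 x1 r1 r2. ennreal (z (r1, observe r1 y1)) * indicator B (y1, x1, r1)"])
        (auto simp: simps cong: nn_integral_cong_simp)
    also have "\<dots> = (\<integral>\<^sup>+\<omega>. ennreal (z (R1 \<omega>, Y \<omega>)) * indicator B (Y1 \<omega>, X1 \<omega>, R1 \<omega>) \<partial>M)"
      by (intro nn_integral_cong) (simp add: Y_observed)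
    finally show "(\<integral>\<^sup>+\<omega>. ennreal (of_bool (R2 \<omega>)) * indicator B (Y1 \<omega>, X1 \<omega>, R1 \<omega>) \<partial>M) =
        (\<integral>\<^sup>+\<omega>. ennreal (z (R1 \<omega>, Y \<omega>)) * indicator B (Y1 \<omega>, X1 \<omega>, R1 \<omega>) \<partial>M)" .
  qed measurable
  have "missingness_probabilities M S Y1 X1 R1 R2 Y X p z"
    by unfold_locales (fact p z le1 z_le1 d1 d2 assms | simp add: p_def z_def)+
  then show ?thesis
    by (rule that)
qed

end

section \<open>Identification\<close>

context missingness_probabilities
begin

section \<open>Exchanging an indicator for its conditional probability\<close>

lemma
  fixes g :: "real \<times> 'b \<Rightarrow> real"
  assumes [measurable]: "g \<in> borel_measurable (borel \<Otimes>\<^sub>M S)"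
  shows integrable_R1_iff: "integrable M (\<lambda>\<omega>. of_bool (R1 \<omega>) * g (Y1 \<omega>, X1 \<omega>)) \<longleftrightarrow>
      integrable M (\<lambda>\<omega>. p (X1 \<omega>) * g (Y1 \<omega>, X1 \<omega>))"
    and integral_R1: "(\<integral>\<omega>. of_bool (R1 \<omega>) * g (Y1 \<omega>, X1 \<omega>) \<partial>M) =
      (\<integral>\<omega>. p (X1 \<omega>) * g (Y1 \<omega>, X1 \<omega>) \<partial>M)"
  by (intro integrable_distr_density_iff[OF _ _ _ _ _ _ distr_R1]
      integral_distr_density_eq[OF _ _ _ _ _ _ distr_R1]; simp add: p_nonneg)+

lemma
  fixes g :: "real \<times> 'b \<times> bool \<Rightarrow> real"
  assumes [measurable]: "g \<in> borel_measurable (borel \<Otimes>\<^sub>M S \<Otimes>\<^sub>M bool_space)"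
  shows integrable_R2_iff: "integrable M (\<lambda>\<omega>. of_bool (R2 \<omega>) * g (Y1 \<omega>, X1 \<omega>, R1 \<omega>)) \<longleftrightarrow>
      integrable M (\<lambda>\<omega>. z (R1 \<omega>, Y \<omega>) * g (Y1 \<omega>, X1 \<omega>, R1 \<omega>))"
    and integral_R2: "(\<integral>\<omega>. of_bool (R2 \<omega>) * g (Y1 \<omega>, X1 \<omega>, R1 \<omega>) \<partial>M) =
      (\<integral>\<omega>. z (R1 \<omega>, Y \<omega>) * g (Y1 \<omega>, X1 \<omega>, R1 \<omega>) \<partial>M)"
  by (intro integrable_distr_density_iff[OF _ _ _ _ _ _ distr_R2]
      integral_distr_density_eq[OF _ _ _ _ _ _ distr_R2]; simp add: z_nonneg)+

section \<open>Positivity of the missingness probabilities and of the conditioning events\<close>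

lemma integrable_p_mult:
  assumes "integrable M f"
  shows "integrable M (\<lambda>\<omega>. p (X1 \<omega>) * f \<omega>)"
proof (rule Bochner_Integration.integrable_bound[OF assms])
  show "AE \<omega> in M. norm (p (X1 \<omega>) * f \<omega>) \<le> norm (f \<omega>)"
    by (intro AE_I2) (auto simp: abs_mult p_nonneg p_le_1 measurable_space[OF measurable_X1]
        intro!: mult_left_le_one_le)
qed (use assms in measurable)

lemma integrable_p: "integrable M (\<lambda>\<omega>. p (X1 \<omega>))"
  using integrable_p_mult[of "\<lambda>_. 1"] by simp

text \<open>By \<open>integral_R1\<close>, \<open>p (X1 \<omega>)\<close> is a version of the
  conditional probability of \<open>R1\<close> given \<open>X1\<close>, so the positivity assumption
  transfers to it.\<close>

lemma AE_p_pos: "AE \<omega> in M. 0 < p (X1 \<omega>)"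
proof -
  have "AE \<omega> in M. real_cond_exp M (sigma_gen M X1 S) (\<lambda>\<omega>. of_bool (R1 \<omega>)) \<omega> = p (X1 \<omega>)"
  proof (rule real_cond_exp_sigma_genI)
    show "integrable M (\<lambda>\<omega>. of_bool (R1 \<omega>) :: real)"
      by (intro integrable_const_bound[where B = 1]) auto
    fix B assume [measurable]: "B \<in> sets S"
    show "(\<integral>\<omega>. of_bool (R1 \<omega>) * indicat_real B (X1 \<omega>) \<partial>M) = (\<integral>\<omega>. p (X1 \<omega>) * indicator B (X1 \<omega>) \<partial>M)"
      using integral_R1[of "\<lambda>v. indicator B (snd v)"] by simp
  qed (simp_all add: integrable_p)
  moreover have "AE \<omega> in M. real_cond_exp M (sigma_gen M X1 S) (\<lambda>\<omega>. of_bool (R1 \<omega>)) \<omega> > 0"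
    using positive by (simp add: positivity_def)
  ultimately show ?thesis
    by eventually_elim simp
qed

text \<open>Events in \<open>(R1, Y)\<close> are events in \<open>(R1, Y1)\<close> because
  \<open>Y\<close> is determined by these two, so \<open>integral_R2\<close> identifies
  \<open>z\<close> as the conditional probability of \<open>R2\<close>.\<close>

lemma AE_z_pos: "AE \<omega> in M. 0 < z (R1 \<omega>, Y \<omega>)"
proof -
  let ?T = "bool_space \<Otimes>\<^sub>M option_space borel :: (bool \<times> real option) measure"
  have "AE \<omega> in M. real_cond_exp M (sigma_gen M (\<lambda>\<omega>. (R1 \<omega>, Y \<omega>)) ?T) (\<lambda>\<omega>. of_bool (R2 \<omega>)) \<omega> =
      z (R1 \<omega>, Y \<omega>)"
  proof (rule real_cond_exp_sigma_genI)
    show "integrable M (\<lambda>\<omega>. of_bool (R2 \<omega>) :: real)"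
      by (intro integrable_const_bound[where B = 1]) auto
    show "integrable M (\<lambda>\<omega>. z (R1 \<omega>, Y \<omega>))"
      by (intro integrable_const_bound[where B = 1]) (auto simp: z_nonneg z_le_1)
    fix B assume [measurable]: "B \<in> sets ?T"
    have *: "(\<integral>\<omega>. f \<omega> * indicator B (R1 \<omega>, Y \<omega>) \<partial>M) =
        (\<integral>\<omega>. f \<omega> * indicator B (R1 \<omega>, observe (R1 \<omega>) (Y1 \<omega>)) \<partial>M)" for f :: "'a \<Rightarrow> real"
      by (intro Bochner_Integration.integral_cong) (simp_all add: Y_observed)
    show "(\<integral>\<omega>. of_bool (R2 \<omega>) * indicat_real B (R1 \<omega>, Y \<omega>) \<partial>M) =
        (\<integral>\<omega>. z (R1 \<omega>, Y \<omega>) * indicator B (R1 \<omega>, Y \<omega>) \<partial>M)"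
      unfolding *
      using integral_R2[of "\<lambda>v. indicator B (snd (snd v), observe (snd (snd v)) (fst v))"] by simp
  qed simp_all
  moreover have "AE \<omega> in M. real_cond_exp M (sigma_gen M (\<lambda>\<omega>. (R1 \<omega>, Y \<omega>)) ?T)
      (\<lambda>\<omega>. of_bool (R2 \<omega>)) \<omega> > 0"
    using positive by (simp add: positivity_def)
  ultimately show ?thesis
    by eventually_elim simp
qed

lemma prob_R1_neq_0: "\<P>(\<omega> in M. R1 \<omega>) \<noteq> 0"
proof
  assume "\<P>(\<omega> in M. R1 \<omega>) = 0"
  then have "(\<integral>\<omega>. p (X1 \<omega>) \<partial>M) = 0"
    using integral_R1[of "\<lambda>_. 1"] by (simp add: prob_eq_integral)
  then have "AE \<omega> in M. p (X1 \<omega>) = 0"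
    by (subst (asm) integral_nonneg_eq_0_iff_AE) (auto simp: integrable_p p_nonneg)
  with AE_p_pos have "AE \<omega> in M. False"
    by eventually_elim simp
  then show False by simp
qed

text \<open>Otherwise \<open>z\<close> would have integral 0 over \<open>R1\<close>; as
  \<open>z\<close> is almost surely positive, \<open>R1\<close> would be null.\<close>

lemma prob_R1_R2_neq_0: "\<P>(\<omega> in M. R1 \<omega> \<and> R2 \<omega>) \<noteq> 0"
proof
  assume "\<P>(\<omega> in M. R1 \<omega> \<and> R2 \<omega>) = 0"
  then have "(\<integral>\<omega>. z (R1 \<omega>, Y \<omega>) * of_bool (R1 \<omega>) \<partial>M) = 0"
    using integral_R2[of "\<lambda>v. of_bool (snd (snd v))"]
    by (simp add: prob_eq_integral of_bool_conj mult.commute)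
  moreover have "integrable M (\<lambda>\<omega>. z (R1 \<omega>, Y \<omega>) * of_bool (R1 \<omega>))"
    by (intro integrable_const_bound[where B = 1]) (auto simp: z_nonneg z_le_1)
  ultimately have "AE \<omega> in M. z (R1 \<omega>, Y \<omega>) * of_bool (R1 \<omega>) = 0"
    by (subst (asm) integral_nonneg_eq_0_iff_AE) (auto simp: z_nonneg)
  with AE_z_pos have "AE \<omega> in M. \<not> R1 \<omega>"
    by eventually_elim auto
  then have "\<P>(\<omega> in M. R1 \<omega>) = 0"
    by (subst prob_Collect_eq_0) auto
  with prob_R1_neq_0 show False ..
qed

text \<open>\<open>\<zeta>\<close> conditions on \<open>Y\<close> under the law given
  \<open>R1\<close>, whereas \<open>z\<close> conditions on the pair \<open>(R1, Y)\<close> under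
  \<open>M\<close>. Restricting test functions to \<open>R1\<close> shows that
  \<open>z (True, Y \<omega>)\<close> is a version of the former as well.\<close>

lemma AE_\<zeta>_eq:
  assumes reg: "regression_version (given M R1) Y (option_space borel) (\<lambda>\<omega>. of_bool (R2 \<omega>)) \<zeta>"
  shows "AE \<omega> in M. R1 \<omega> \<longrightarrow> \<zeta> (Y \<omega>) = z (True, Y \<omega>)"
proof -
  interpret N: finite_measure "given M R1"
    by (rule finite_measure_given) simp
  have "AE \<omega> in given M R1. real_cond_exp (given M R1) (sigma_gen (given M R1) Y (option_space borel))
      (\<lambda>\<omega>. of_bool (R2 \<omega>)) \<omega> = z (True, Y \<omega>)"
  proof (rule N.real_cond_exp_sigma_genI)
    show "integrable (given M R1) (\<lambda>\<omega>. of_bool (R2 \<omega>) :: real)"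
      by (intro integrable_given integrable_of_bool_mult integrable_const_bound[where B = 1]) auto
    show "integrable (given M R1) (\<lambda>\<omega>. z (True, Y \<omega>))"
      by (intro integrable_given integrable_of_bool_mult integrable_const_bound[where B = 1])
        (auto simp: z_nonneg z_le_1)
    fix B :: "real option set" assume [measurable]: "B \<in> sets (option_space borel)"
    have "(\<integral>\<omega>. of_bool (R1 \<omega>) * (of_bool (R2 \<omega>) * indicat_real B (Y \<omega>)) \<partial>M) =
        (\<integral>\<omega>. of_bool (R2 \<omega>) * (of_bool (R1 \<omega>) * indicat_real B (observe (R1 \<omega>) (Y1 \<omega>))) \<partial>M)"
      by (intro Bochner_Integration.integral_cong) (auto simp: Y_observed)
    also have "\<dots> = (\<integral>\<omega>. z (R1 \<omega>, Y \<omega>) * (of_bool (R1 \<omega>) * indicat_real B (observe (R1 \<omega>) (Y1 \<omega>))) \<partial>M)"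
      using integral_R2[of "\<lambda>v. of_bool (snd (snd v)) * indicator B (observe (snd (snd v)) (fst v))"]
      by simp
    also have "\<dots> = (\<integral>\<omega>. of_bool (R1 \<omega>) * (z (True, Y \<omega>) * indicat_real B (Y \<omega>)) \<partial>M)"
      by (intro Bochner_Integration.integral_cong) (auto simp: Y_observed)
    finally show "(\<integral>\<omega>. of_bool (R2 \<omega>) * indicat_real B (Y \<omega>) \<partial>given M R1) =
        (\<integral>\<omega>. z (True, Y \<omega>) * indicator B (Y \<omega>) \<partial>given M R1)"
      by (simp add: integral_given)
  qed (simp_all add: measurable_given)
  moreover have "AE \<omega> in given M R1. real_cond_exp (given M R1)
      (sigma_gen (given M R1) Y (option_space borel)) (\<lambda>\<omega>. of_bool (R2 \<omega>)) \<omega> = \<zeta> (Y \<omega>)"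
    using reg by (simp add: regression_version_def)
  ultimately have "AE \<omega> in given M R1. \<zeta> (Y \<omega>) = z (True, Y \<omega>)"
    by eventually_elim simp
  then show ?thesis
    using prob_R1_neq_0 by (subst (asm) AE_given_iff) auto
qed

lemma expectation_Y1_split:
  assumes integrable_Y1: "integrable M Y1"
  shows "(\<integral>\<omega>. Y1 \<omega> \<partial>M) = \<P>(\<omega> in M. R1 \<omega>) * (\<integral>\<omega>. the (Y \<omega>) \<partial>(given M R1))
    + \<P>(\<omega> in M. \<not> R1 \<omega>) * (\<integral>\<omega>. Y1 \<omega> \<partial>(given M (\<lambda>\<omega>. \<not> R1 \<omega>)))"
proof -
  have "(\<integral>\<omega>. of_bool (R1 \<omega>) * the (Y \<omega>) \<partial>M) = (\<integral>\<omega>. of_bool (R1 \<omega>) * Y1 \<omega> \<partial>M)"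
    by (intro Bochner_Integration.integral_cong) (auto simp: Y_observed observe_def)
  then have 1: "\<P>(\<omega> in M. R1 \<omega>) * (\<integral>\<omega>. the (Y \<omega>) \<partial>(given M R1)) = (\<integral>\<omega>. of_bool (R1 \<omega>) * Y1 \<omega> \<partial>M)"
    using prob_R1_neq_0 by (simp add: integral_given)
  have 2: "\<P>(\<omega> in M. \<not> R1 \<omega>) * (\<integral>\<omega>. Y1 \<omega> \<partial>(given M (\<lambda>\<omega>. \<not> R1 \<omega>))) =
      (\<integral>\<omega>. of_bool (\<not> R1 \<omega>) * Y1 \<omega> \<partial>M)"
  \<comment> \<open>If \<open>R1\<close> holds almost surely, the zero factor on the left matches
    the integral of a function that vanishes almost everywhere.\<close>
  proof (cases "\<P>(\<omega> in M. \<not> R1 \<omega>) = 0")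
    case True
    then have "AE \<omega> in M. R1 \<omega>"
      by (subst (asm) prob_Collect_eq_0) auto
    then have "AE \<omega> in M. of_bool (\<not> R1 \<omega>) * Y1 \<omega> = 0"
      by eventually_elim simp
    then have "(\<integral>\<omega>. of_bool (\<not> R1 \<omega>) * Y1 \<omega> \<partial>M) = 0"
      by (rule integral_eq_zero_AE)
    with True show ?thesis by simp
  qed (simp add: integral_given)
  have "(\<integral>\<omega>. Y1 \<omega> \<partial>M) = (\<integral>\<omega>. of_bool (R1 \<omega>) * Y1 \<omega> + of_bool (\<not> R1 \<omega>) * Y1 \<omega> \<partial>M)"
    by (intro Bochner_Integration.integral_cong) auto
  also have "\<dots> = (\<integral>\<omega>. of_bool (R1 \<omega>) * Y1 \<omega> \<partial>M) + (\<integral>\<omega>. of_bool (\<not> R1 \<omega>) * Y1 \<omega> \<partial>M)"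
    by (intro Bochner_Integration.integral_add integrable_of_bool_mult integrable_Y1) simp_all
  finally show ?thesis
    unfolding 1 2 .
qed

section \<open>Inverse weighting of the complete cases\<close>

context
  fixes \<zeta> :: "real option \<Rightarrow> real"
  assumes reg_\<zeta>: "regression_version (given M R1) Y (option_space borel) (\<lambda>\<omega>. of_bool (R2 \<omega>)) \<zeta>"
begin

lemma measurable_\<zeta> [measurable]: "\<zeta> \<in> borel_measurable (option_space borel)"
  using reg_\<zeta> by (simp add: regression_version_def)

lemma
  fixes u :: "real \<times> 'b \<Rightarrow> real"
  assumes [measurable]: "u \<in> borel_measurable (borel \<Otimes>\<^sub>M S)"
  shows integrable_inverse_weight_iff:
      "integrable M (\<lambda>\<omega>. of_bool (R1 \<omega> \<and> R2 \<omega>) * (u (Y1 \<omega>, X1 \<omega>) / \<zeta> (Y \<omega>))) \<longleftrightarrow>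
        integrable M (\<lambda>\<omega>. p (X1 \<omega>) * u (Y1 \<omega>, X1 \<omega>))"
    and integral_inverse_weight:
      "(\<integral>\<omega>. of_bool (R1 \<omega> \<and> R2 \<omega>) * (u (Y1 \<omega>, X1 \<omega>) / \<zeta> (Y \<omega>)) \<partial>M) =
        (\<integral>\<omega>. p (X1 \<omega>) * u (Y1 \<omega>, X1 \<omega>) \<partial>M)"
proof -
  \<comment> \<open>On \<open>R1\<close> the observed value is \<open>Some (Y1 \<omega>)\<close>, so
    \<open>\<zeta> (Y \<omega>)\<close> may be replaced by this denominator. Then \<open>g\<close>
    is a function of \<open>(Y1, X1, R1)\<close>, as the exchange of \<open>R2\<close> requires, and
    the weight \<open>z\<close> cancels the denominator exactly.\<close>
  define g where "g v = of_bool (snd (snd v)) * (u (fst v, fst (snd v)) / z (True, Some (fst v)))"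
    for v :: "real \<times> 'b \<times> bool"
  have [measurable]: "g \<in> borel_measurable (borel \<Otimes>\<^sub>M S \<Otimes>\<^sub>M bool_space)"
    unfolding g_def by measurable
  have 1: "AE \<omega> in M. of_bool (R1 \<omega> \<and> R2 \<omega>) * (u (Y1 \<omega>, X1 \<omega>) / \<zeta> (Y \<omega>)) =
      of_bool (R2 \<omega>) * g (Y1 \<omega>, X1 \<omega>, R1 \<omega>)"
    using AE_\<zeta>_eq[OF reg_\<zeta>] AE_space
    by eventually_elim (auto simp: g_def Y_observed observe_def)
  have 2: "AE \<omega> in M. z (R1 \<omega>, Y \<omega>) * g (Y1 \<omega>, X1 \<omega>, R1 \<omega>) = of_bool (R1 \<omega>) * u (Y1 \<omega>, X1 \<omega>)"
    using AE_z_pos AE_space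
    by eventually_elim (auto simp: g_def Y_observed observe_def)
  have "integrable M (\<lambda>\<omega>. of_bool (R1 \<omega> \<and> R2 \<omega>) * (u (Y1 \<omega>, X1 \<omega>) / \<zeta> (Y \<omega>))) \<longleftrightarrow>
      integrable M (\<lambda>\<omega>. of_bool (R2 \<omega>) * g (Y1 \<omega>, X1 \<omega>, R1 \<omega>))"
    using 1 by (intro integrable_cong_AE) auto
  also have "\<dots> \<longleftrightarrow> integrable M (\<lambda>\<omega>. z (R1 \<omega>, Y \<omega>) * g (Y1 \<omega>, X1 \<omega>, R1 \<omega>))"
    by (rule integrable_R2_iff) simp
  also have "\<dots> \<longleftrightarrow> integrable M (\<lambda>\<omega>. of_bool (R1 \<omega>) * u (Y1 \<omega>, X1 \<omega>))"
    using 2 by (intro integrable_cong_AE) auto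
  finally show "integrable M (\<lambda>\<omega>. of_bool (R1 \<omega> \<and> R2 \<omega>) * (u (Y1 \<omega>, X1 \<omega>) / \<zeta> (Y \<omega>))) \<longleftrightarrow>
      integrable M (\<lambda>\<omega>. p (X1 \<omega>) * u (Y1 \<omega>, X1 \<omega>))"
    by (simp add: integrable_R1_iff)
  have "(\<integral>\<omega>. of_bool (R1 \<omega> \<and> R2 \<omega>) * (u (Y1 \<omega>, X1 \<omega>) / \<zeta> (Y \<omega>)) \<partial>M) =
      (\<integral>\<omega>. of_bool (R2 \<omega>) * g (Y1 \<omega>, X1 \<omega>, R1 \<omega>) \<partial>M)"
    using 1 by (intro integral_cong_AE) auto
  also have "\<dots> = (\<integral>\<omega>. z (R1 \<omega>, Y \<omega>) * g (Y1 \<omega>, X1 \<omega>, R1 \<omega>) \<partial>M)"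
    by (rule integral_R2) simp
  also have "\<dots> = (\<integral>\<omega>. of_bool (R1 \<omega>) * u (Y1 \<omega>, X1 \<omega>) \<partial>M)"
    using 2 by (intro integral_cong_AE) auto
  finally show "(\<integral>\<omega>. of_bool (R1 \<omega> \<and> R2 \<omega>) * (u (Y1 \<omega>, X1 \<omega>) / \<zeta> (Y \<omega>)) \<partial>M) =
      (\<integral>\<omega>. p (X1 \<omega>) * u (Y1 \<omega>, X1 \<omega>) \<partial>M)"
    by (simp add: integral_R1)
qed

text \<open>Taking \<open>u\<close> as the identity gives the numerator and \<open>u\<close>
  constantly 1 the denominator. On complete cases \<open>X\<close> is
  \<open>Some (X1 \<omega>)\<close>, which turns a regression on the observed \<open>X\<close> into
  a statement about \<open>X1\<close>.\<close>

lemma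
  fixes u :: "real \<Rightarrow> real" and c :: "'b option \<Rightarrow> real"
  assumes u[measurable]: "u \<in> borel_measurable borel" and int: "integrable M (\<lambda>\<omega>. u (Y1 \<omega>))"
    and reg: "regression_version (given M (\<lambda>\<omega>. R1 \<omega> \<and> R2 \<omega>)) X (option_space S)
      (\<lambda>\<omega>. u (the (Y \<omega>)) / \<zeta> (Y \<omega>)) c"
  shows integrable_complete_case_regression:
      "integrable M (\<lambda>\<omega>. of_bool (R1 \<omega> \<and> R2 \<omega>) * c (Some (X1 \<omega>)))"
    and integral_complete_case_regression:
      "B \<in> sets S \<Longrightarrow>
        (\<integral>\<omega>. of_bool (R1 \<omega> \<and> R2 \<omega>) * c (Some (X1 \<omega>)) * indicator B (X1 \<omega>) \<partial>M) =
        (\<integral>\<omega>. p (X1 \<omega>) * u (Y1 \<omega>) * indicator B (X1 \<omega>) \<partial>M)"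
proof -
  let ?P = "\<lambda>\<omega>. R1 \<omega> \<and> R2 \<omega>"
  let ?f = "\<lambda>\<omega>. u (the (Y \<omega>)) / \<zeta> (Y \<omega>)"
  interpret N: finite_measure "given M ?P"
    by (rule finite_measure_given) simp
  have [measurable]: "c \<in> borel_measurable (option_space S)"
    using reg by (simp add: regression_version_def)
  \<comment> \<open>No lower bound on \<open>\<zeta>\<close> is available. Integrability of the
    weighted variable comes from the inverse weighting equivalence together with the bound of
    \<open>p\<close> by 1.\<close>
  have "integrable M (\<lambda>\<omega>. of_bool (?P \<omega>) * (u (Y1 \<omega>) / \<zeta> (Y \<omega>)))"
    using integrable_inverse_weight_iff[of "\<lambda>v. u (fst v)"] integrable_p_mult[OF int] by simp
  also have "?this \<longleftrightarrow> integrable M (\<lambda>\<omega>. of_bool (?P \<omega>) * ?f \<omega>)"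
    by (intro Bochner_Integration.integrable_cong) (auto simp: Y_observed observe_def)
  finally have int_f: "integrable (given M ?P) ?f"
    by (intro integrable_given) simp_all
  have X: "X \<in> given M ?P \<rightarrow>\<^sub>M option_space S"
    by (simp add: measurable_given)
  note reg = N.regression_versionD[OF X int_f reg]
  have "integrable M (\<lambda>\<omega>. of_bool (?P \<omega>) * c (X \<omega>))"
    using reg(1) prob_R1_R2_neq_0 by (intro integrable_of_bool_mult_given) simp_all
  also have "?this \<longleftrightarrow> integrable M (\<lambda>\<omega>. of_bool (?P \<omega>) * c (Some (X1 \<omega>)))"
    by (intro Bochner_Integration.integrable_cong) (auto simp: X_observed observe_def)
  finally show "integrable M (\<lambda>\<omega>. of_bool (?P \<omega>) * c (Some (X1 \<omega>)))" .
  assume B[measurable]: "B \<in> sets S"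
  then have SB[measurable]: "Some ` B \<in> sets (option_space S)"
    by (rule sets_option_space_image_Some)
  have "(\<integral>\<omega>. of_bool (?P \<omega>) * c (Some (X1 \<omega>)) * indicator B (X1 \<omega>) \<partial>M) =
      (\<integral>\<omega>. of_bool (?P \<omega>) * (c (X \<omega>) * indicator (Some ` B) (X \<omega>)) \<partial>M)"
    by (intro Bochner_Integration.integral_cong) (auto simp: X_observed observe_def indicator_def)
  also have "\<dots> = (\<integral>\<omega>. of_bool (?P \<omega>) * (?f \<omega> * indicator (Some ` B) (X \<omega>)) \<partial>M)"
    using reg(2)[OF SB] prob_R1_R2_neq_0 by (simp add: integral_given)
  also have "\<dots> = (\<integral>\<omega>. of_bool (?P \<omega>) * (u (Y1 \<omega>) * indicator B (X1 \<omega>) / \<zeta> (Y \<omega>)) \<partial>M)"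
    by (intro Bochner_Integration.integral_cong)
      (auto simp: X_observed Y_observed observe_def indicator_def)
  also have "\<dots> = (\<integral>\<omega>. p (X1 \<omega>) * (u (Y1 \<omega>) * indicator B (X1 \<omega>)) \<partial>M)"
    using integral_inverse_weight[of "\<lambda>v. u (fst v) * indicator B (snd v)"] by simp
  finally show "(\<integral>\<omega>. of_bool (?P \<omega>) * c (Some (X1 \<omega>)) * indicator B (X1 \<omega>) \<partial>M) =
      (\<integral>\<omega>. p (X1 \<omega>) * u (Y1 \<omega>) * indicator B (X1 \<omega>) \<partial>M)"
    by (simp add: mult.assoc)
qed

section \<open>The ratio of the two regressions and the mean given \<open>R1 = 0\<close>\<close>

context
  fixes num den :: "'b option \<Rightarrow> real"
  assumes integrable_Y1: "integrable M Y1"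
    and reg_num: "regression_version (given M (\<lambda>\<omega>. R1 \<omega> \<and> R2 \<omega>)) X (option_space S)
      (\<lambda>\<omega>. the (Y \<omega>) / \<zeta> (Y \<omega>)) num"
    and reg_den: "regression_version (given M (\<lambda>\<omega>. R1 \<omega> \<and> R2 \<omega>)) X (option_space S)
      (\<lambda>\<omega>. 1 / \<zeta> (Y \<omega>)) den"
begin

lemma measurable_num_den [measurable]:
  "num \<in> borel_measurable (option_space S)" "den \<in> borel_measurable (option_space S)"
  using reg_num reg_den by (simp_all add: regression_version_def)

lemma integrable_num: "integrable M (\<lambda>\<omega>. of_bool (R1 \<omega> \<and> R2 \<omega>) * num (Some (X1 \<omega>)))"
  by (rule integrable_complete_case_regression[where u = "\<lambda>y. y",
        OF measurable_ident_sets[OF refl] integrable_Y1 reg_num])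

lemma integrable_den: "integrable M (\<lambda>\<omega>. of_bool (R1 \<omega> \<and> R2 \<omega>) * den (Some (X1 \<omega>)))"
proof -
  have "(\<lambda>_. 1 :: real) \<in> borel_measurable borel" "integrable M (\<lambda>_. 1 :: real)"
    by simp_all
  from integrable_complete_case_regression[where u = "\<lambda>_. 1", OF this reg_den]
  show ?thesis .
qed

lemma integral_num:
  "B \<in> sets S \<Longrightarrow> (\<integral>\<omega>. of_bool (R1 \<omega> \<and> R2 \<omega>) * num (Some (X1 \<omega>)) * indicator B (X1 \<omega>) \<partial>M) =
    (\<integral>\<omega>. p (X1 \<omega>) * Y1 \<omega> * indicator B (X1 \<omega>) \<partial>M)"
  by (rule integral_complete_case_regression[where u = "\<lambda>y. y",
        OF measurable_ident_sets[OF refl] integrable_Y1 reg_num])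

lemma integral_den:
  assumes "B \<in> sets S"
  shows "(\<integral>\<omega>. of_bool (R1 \<omega> \<and> R2 \<omega>) * den (Some (X1 \<omega>)) * indicator B (X1 \<omega>) \<partial>M) =
    (\<integral>\<omega>. p (X1 \<omega>) * indicator B (X1 \<omega>) \<partial>M)"
proof -
  have "(\<lambda>_. 1 :: real) \<in> borel_measurable borel" "integrable M (\<lambda>_. 1 :: real)"
    by simp_all
  from integral_complete_case_regression[where u = "\<lambda>_. 1", OF this reg_den assms]
  show ?thesis
    by simp
qed

text \<open>Over the set \<open>B\<close> where \<open>den\<close> is not positive, the
  complete-case integral of \<open>den\<close> is at most 0, yet it equals the integral of
  \<open>p\<close> over the event that \<open>X1\<close> lies in \<open>B\<close>. Since
  \<open>p\<close> is almost surely positive, that event is null under \<open>M\<close> itself, and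
  not only among complete cases.\<close>

lemma AE_den_pos: "AE \<omega> in M. 0 < den (Some (X1 \<omega>))"
proof -
  define B where "B = {x \<in> space S. den (Some x) \<le> 0}"
  have B[measurable]: "B \<in> sets S"
    unfolding B_def by measurable
  have int: "integrable M (\<lambda>\<omega>. p (X1 \<omega>) * indicator B (X1 \<omega>))"
    by (intro integrable_p_mult integrable_const_bound[where B = 1]) auto
  have "(\<integral>\<omega>. p (X1 \<omega>) * indicator B (X1 \<omega>) \<partial>M) =
      (\<integral>\<omega>. of_bool (R1 \<omega> \<and> R2 \<omega>) * den (Some (X1 \<omega>)) * indicator B (X1 \<omega>) \<partial>M)"
    by (simp add: integral_den)
  also have "\<dots> \<le> 0"
  proof -
    have "0 \<le> (\<integral>\<omega>. - (of_bool (R1 \<omega> \<and> R2 \<omega>) * den (Some (X1 \<omega>)) * indicator B (X1 \<omega>)) \<partial>M)"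
      by (intro integral_nonneg_AE AE_I2) (auto simp: B_def indicator_def)
    then show ?thesis by simp
  qed
  finally have "(\<integral>\<omega>. p (X1 \<omega>) * indicator B (X1 \<omega>) \<partial>M) = 0"
    by (intro antisym) (auto intro!: integral_nonneg_AE simp: p_nonneg)
  with int have "AE \<omega> in M. p (X1 \<omega>) * indicator B (X1 \<omega>) = 0"
    by (subst (asm) integral_nonneg_eq_0_iff_AE) (auto simp: p_nonneg)
  then show ?thesis
    using AE_p_pos AE_space
    by eventually_elim
      (use measurable_space[OF measurable_X1] in \<open>auto simp: B_def indicator_def not_le split: if_splits\<close>)
qed

lemma AE_real_cond_exp_eq_ratio:
  "AE \<omega> in M. real_cond_exp M (sigma_gen M X1 S) Y1 \<omega> = num (Some (X1 \<omega>)) / den (Some (X1 \<omega>))"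
proof -
  interpret sigma_finite_subalgebra M "sigma_gen M X1 S"
    by (rule sigma_finite_subalgebra_sigma_gen) simp
  have X1_sigma[measurable]: "X1 \<in> sigma_gen M X1 S \<rightarrow>\<^sub>M S"
    by (rule measurable_sigma_gen) simp
  define w where "w \<omega> = of_bool (R1 \<omega> \<and> R2 \<omega>) * den (Some (X1 \<omega>))" for \<omega>
  define m where "m x = num (Some x) / den (Some x)" for x
  have [measurable]: "w \<in> borel_measurable M"
    unfolding w_def by measurable
  have [measurable]: "m \<in> borel_measurable S"
    unfolding m_def by measurable
  have w_nonneg: "AE \<omega> in M. 0 \<le> w \<omega>"
    using AE_den_pos by eventually_elim (simp add: w_def)
  txt \<open>Reweighting by \<open>den\<close> turns complete cases into the law with density \<open>p(X1)\<close>, in which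
    \<open>num(X)/den(X)\<close> is then the regression of \<open>Y1\<close> on \<open>X1\<close>.\<close>
  have distr_w: "distr (density M w) S X1 = distr (density M (\<lambda>\<omega>. p (X1 \<omega>))) S X1"
    using w_nonneg integrable_den integrable_p integral_den
    by (intro distr_density_eq_integralI) (simp_all add: w_def p_nonneg)
  have w_m: "AE \<omega> in M. w \<omega> * m (X1 \<omega>) = of_bool (R1 \<omega> \<and> R2 \<omega>) * num (Some (X1 \<omega>))"
    using AE_den_pos by eventually_elim (simp add: w_def m_def)
  have "integrable M (\<lambda>\<omega>. w \<omega> * m (X1 \<omega>))"
    using w_m integrable_num by (subst integrable_cong_AE[OF _ _ w_m]) auto
  then have int_m: "integrable M (\<lambda>\<omega>. p (X1 \<omega>) * m (X1 \<omega>))"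
    using w_nonneg by (subst (asm) integrable_distr_density_iff[OF _ _ _ _ _ _ distr_w]) (auto simp: p_nonneg)
  \<comment> \<open>So far only the product of \<open>p\<close> and \<open>m\<close> is known to be
    integrable, so the regression of \<open>p (X1 \<omega>) * Y1 \<omega>\<close> is identified
    first. The factor \<open>p (X1 \<omega>)\<close> is then pulled out and cancelled by
    positivity.\<close>
  have "AE \<omega> in M. real_cond_exp M (sigma_gen M X1 S) (\<lambda>\<omega>. p (X1 \<omega>) * Y1 \<omega>) \<omega> =
      p (X1 \<omega>) * m (X1 \<omega>)"
  proof (rule real_cond_exp_sigma_genI[where g = "\<lambda>x. p x * m x"])
    fix B assume B[measurable]: "B \<in> sets S"
    have "(\<integral>\<omega>. p (X1 \<omega>) * Y1 \<omega> * indicator B (X1 \<omega>) \<partial>M) =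
        (\<integral>\<omega>. of_bool (R1 \<omega> \<and> R2 \<omega>) * num (Some (X1 \<omega>)) * indicator B (X1 \<omega>) \<partial>M)"
      by (simp add: integral_num)
    also have "\<dots> = (\<integral>\<omega>. w \<omega> * (m (X1 \<omega>) * indicator B (X1 \<omega>)) \<partial>M)"
    proof (rule integral_cong_AE)
      show "AE \<omega> in M. of_bool (R1 \<omega> \<and> R2 \<omega>) * num (Some (X1 \<omega>)) * indicator B (X1 \<omega>) =
          w \<omega> * (m (X1 \<omega>) * indicator B (X1 \<omega>))"
        using w_m by eventually_elim (simp add: mult.assoc[symmetric])
    qed measurable
    also have "\<dots> = (\<integral>\<omega>. p (X1 \<omega>) * (m (X1 \<omega>) * indicator B (X1 \<omega>)) \<partial>M)"
      using w_nonneg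
      by (intro integral_distr_density_eq[OF _ _ _ _ _ _ distr_w, of "\<lambda>x. m x * indicator B x"])
        (auto simp: p_nonneg)
    finally show "(\<integral>\<omega>. p (X1 \<omega>) * Y1 \<omega> * indicator B (X1 \<omega>) \<partial>M) =
        (\<integral>\<omega>. p (X1 \<omega>) * m (X1 \<omega>) * indicator B (X1 \<omega>) \<partial>M)"
      by (simp add: mult.assoc)
  qed (simp_all add: int_m integrable_p_mult integrable_Y1)
  moreover have "AE \<omega> in M. real_cond_exp M (sigma_gen M X1 S) (\<lambda>\<omega>. p (X1 \<omega>) * Y1 \<omega>) \<omega> =
      p (X1 \<omega>) * real_cond_exp M (sigma_gen M X1 S) Y1 \<omega>"
    using integrable_p_mult[OF integrable_Y1]
    by (intro real_cond_exp_mult measurable_compose[OF X1_sigma]) auto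
  ultimately have "AE \<omega> in M. real_cond_exp M (sigma_gen M X1 S) Y1 \<omega> = m (X1 \<omega>)"
    using AE_p_pos by eventually_elim simp
  then show ?thesis
    by (simp add: m_def)
qed

text \<open>Given \<open>X1\<close>, the event \<open>R1 = 0\<close> has probability
  \<open>1 - p (X1 \<omega>)\<close> independently of \<open>Y1\<close>. Both sides are therefore
  integrals against this weight, which is a function of \<open>X1\<close>, so \<open>Y1\<close> and
  its regression on \<open>X1\<close> have the same integral.\<close>

lemma integral_ratio_not_R1:
  "(\<integral>\<omega>. of_bool (\<not> R1 \<omega>) * (num (Some (X1 \<omega>)) / den (Some (X1 \<omega>))) \<partial>M) =
    (\<integral>\<omega>. of_bool (\<not> R1 \<omega>) * Y1 \<omega> \<partial>M)"
proof -
  interpret sigma_finite_subalgebra M "sigma_gen M X1 S"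
    by (rule sigma_finite_subalgebra_sigma_gen) simp
  have X1_sigma[measurable]: "X1 \<in> sigma_gen M X1 S \<rightarrow>\<^sub>M S"
    by (rule measurable_sigma_gen) simp
  let ?e = "real_cond_exp M (sigma_gen M X1 S) Y1"
  define m where "m x = num (Some x) / den (Some x)" for x
  have [measurable]: "m \<in> borel_measurable S"
    unfolding m_def by measurable
  have e_m: "AE \<omega> in M. ?e \<omega> = m (X1 \<omega>)"
    using AE_real_cond_exp_eq_ratio by (simp add: m_def)
  \<comment> \<open>Being almost everywhere the conditional expectation of an integrable variable,
    the ratio is now integrable without the weight \<open>p\<close>.\<close>
  have int_m: "integrable M (\<lambda>\<omega>. m (X1 \<omega>))"
    using real_cond_exp_int(1)[OF integrable_Y1] e_m by (subst (asm) integrable_cong_AE) auto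
  have int_e: "(\<integral>\<omega>. p (X1 \<omega>) * m (X1 \<omega>) \<partial>M) = (\<integral>\<omega>. p (X1 \<omega>) * ?e \<omega> \<partial>M)"
    using e_m by (intro integral_cong_AE) auto
  have not_R1: "(\<integral>\<omega>. of_bool (\<not> R1 \<omega>) * g (Y1 \<omega>, X1 \<omega>) \<partial>M) =
      (\<integral>\<omega>. g (Y1 \<omega>, X1 \<omega>) \<partial>M) - (\<integral>\<omega>. p (X1 \<omega>) * g (Y1 \<omega>, X1 \<omega>) \<partial>M)"
    if [measurable]: "g \<in> borel_measurable (borel \<Otimes>\<^sub>M S)" and int: "integrable M (\<lambda>\<omega>. g (Y1 \<omega>, X1 \<omega>))"
    for g :: "real \<times> 'b \<Rightarrow> real"
  proof -
    have "(\<integral>\<omega>. of_bool (\<not> R1 \<omega>) * g (Y1 \<omega>, X1 \<omega>) \<partial>M) =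
        (\<integral>\<omega>. g (Y1 \<omega>, X1 \<omega>) - of_bool (R1 \<omega>) * g (Y1 \<omega>, X1 \<omega>) \<partial>M)"
      by (intro Bochner_Integration.integral_cong) auto
    also have "\<dots> = (\<integral>\<omega>. g (Y1 \<omega>, X1 \<omega>) \<partial>M) - (\<integral>\<omega>. of_bool (R1 \<omega>) * g (Y1 \<omega>, X1 \<omega>) \<partial>M)"
      using int integrable_of_bool_mult[OF measurable_R1 int]
      by (intro Bochner_Integration.integral_diff) auto
    finally show ?thesis
      by (simp add: integral_R1)
  qed
  have "(\<integral>\<omega>. of_bool (\<not> R1 \<omega>) * m (X1 \<omega>) \<partial>M) =
      (\<integral>\<omega>. m (X1 \<omega>) \<partial>M) - (\<integral>\<omega>. p (X1 \<omega>) * m (X1 \<omega>) \<partial>M)"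
    using not_R1[of "\<lambda>v. m (snd v)"] int_m by simp
  also have "(\<integral>\<omega>. m (X1 \<omega>) \<partial>M) = (\<integral>\<omega>. ?e \<omega> \<partial>M)"
    using e_m by (intro integral_cong_AE) auto
  also have "(\<integral>\<omega>. ?e \<omega> \<partial>M) = (\<integral>\<omega>. Y1 \<omega> \<partial>M)"
    by (rule real_cond_exp_int(2)[OF integrable_Y1])
  also have "(\<integral>\<omega>. p (X1 \<omega>) * m (X1 \<omega>) \<partial>M) = (\<integral>\<omega>. p (X1 \<omega>) * Y1 \<omega> \<partial>M)"
    unfolding int_e
    by (rule real_cond_exp_intg(2)[OF integrable_p_mult[OF integrable_Y1]])
      (auto intro: measurable_compose[OF X1_sigma])
  also have "(\<integral>\<omega>. Y1 \<omega> \<partial>M) - (\<integral>\<omega>. p (X1 \<omega>) * Y1 \<omega> \<partial>M) =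
      (\<integral>\<omega>. of_bool (\<not> R1 \<omega>) * Y1 \<omega> \<partial>M)"
    using not_R1[of fst] integrable_Y1 by simp
  finally show ?thesis
    by (simp add: m_def)
qed

lemma integral_given_not_R1_eq:
  "(\<integral>\<omega>. Y1 \<omega> \<partial>(given M (\<lambda>\<omega>. \<not> R1 \<omega>))) =
    (\<integral>\<omega>. num (X \<omega>) / den (X \<omega>) \<partial>(given M (\<lambda>\<omega>. \<not> R1 \<omega> \<and> R2 \<omega>)))"
proof -
  \<comment> \<open>Whenever \<open>R1\<close> fails, \<open>Y\<close> is \<open>None\<close>, so
    \<open>z (R1 \<omega>, Y \<omega>)\<close> takes this single value there. Selection by
    \<open>R2\<close> then only multiplies integrals over \<open>R1 = 0\<close> by a constant, which
    cancels in the conditional mean.\<close>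
  define q where "q = z (False, None)"
  have q: "(\<integral>\<omega>. of_bool (\<not> R1 \<omega> \<and> R2 \<omega>) * g (X1 \<omega>) \<partial>M) = q * (\<integral>\<omega>. of_bool (\<not> R1 \<omega>) * g (X1 \<omega>) \<partial>M)"
    if [measurable]: "g \<in> borel_measurable S" for g :: "'b \<Rightarrow> real"
  proof -
    have "(\<integral>\<omega>. of_bool (\<not> R1 \<omega> \<and> R2 \<omega>) * g (X1 \<omega>) \<partial>M) =
        (\<integral>\<omega>. of_bool (R2 \<omega>) * (of_bool (\<not> R1 \<omega>) * g (X1 \<omega>)) \<partial>M)"
      by (intro Bochner_Integration.integral_cong) auto
    also have "\<dots> = (\<integral>\<omega>. z (R1 \<omega>, Y \<omega>) * (of_bool (\<not> R1 \<omega>) * g (X1 \<omega>)) \<partial>M)"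
      using integral_R2[of "\<lambda>v. of_bool (\<not> snd (snd v)) * g (fst (snd v))"] by simp
    also have "\<dots> = (\<integral>\<omega>. q * (of_bool (\<not> R1 \<omega>) * g (X1 \<omega>)) \<partial>M)"
      by (intro Bochner_Integration.integral_cong) (auto simp: q_def Y_observed observe_def)
    finally show ?thesis by simp
  qed
  have "(\<integral>\<omega>. num (X \<omega>) / den (X \<omega>) \<partial>(given M (\<lambda>\<omega>. \<not> R1 \<omega> \<and> R2 \<omega>))) =
      (\<integral>\<omega>. of_bool (\<not> R1 \<omega> \<and> R2 \<omega>) * (num (X \<omega>) / den (X \<omega>)) \<partial>M) / \<P>(\<omega> in M. \<not> R1 \<omega> \<and> R2 \<omega>)"
    by (rule integral_given) simp_all
  also have "(\<integral>\<omega>. of_bool (\<not> R1 \<omega> \<and> R2 \<omega>) * (num (X \<omega>) / den (X \<omega>)) \<partial>M) =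
      (\<integral>\<omega>. of_bool (\<not> R1 \<omega> \<and> R2 \<omega>) * (num (Some (X1 \<omega>)) / den (Some (X1 \<omega>))) \<partial>M)"
    by (intro Bochner_Integration.integral_cong) (auto simp: X_observed observe_def)
  also have "\<dots> = q * (\<integral>\<omega>. of_bool (\<not> R1 \<omega>) * Y1 \<omega> \<partial>M)"
    using q[of "\<lambda>x. num (Some x) / den (Some x)"] integral_ratio_not_R1 by simp
  also have "\<P>(\<omega> in M. \<not> R1 \<omega> \<and> R2 \<omega>) = q * \<P>(\<omega> in M. \<not> R1 \<omega>)"
    using q[of "\<lambda>_. 1"] by (simp add: prob_eq_integral)
  finally have *: "(\<integral>\<omega>. num (X \<omega>) / den (X \<omega>) \<partial>(given M (\<lambda>\<omega>. \<not> R1 \<omega> \<and> R2 \<omega>))) =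
      q * (\<integral>\<omega>. of_bool (\<not> R1 \<omega>) * Y1 \<omega> \<partial>M) / (q * \<P>(\<omega> in M. \<not> R1 \<omega>))" .
  \<comment> \<open>Cancelling \<open>q\<close> is at issue only when \<open>R1 = 0\<close> has
    positive probability; on a null event both sides are 0 by division by zero. In the former case
    \<open>q = 0\<close> would contradict the almost sure positivity of \<open>z\<close>.\<close>
  have "q \<noteq> 0" if "\<P>(\<omega> in M. \<not> R1 \<omega>) \<noteq> 0"
  proof
    assume "q = 0"
    have "AE \<omega> in M. R1 \<omega>"
      using AE_z_pos AE_space
      by eventually_elim (use \<open>q = 0\<close> in \<open>auto simp: q_def Y_observed observe_def split: if_splits\<close>)
    then have "\<P>(\<omega> in M. \<not> R1 \<omega>) = 0"
      by (subst prob_Collect_eq_0) auto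
    with that show False ..
  qed
  then show ?thesis
    unfolding * by (subst integral_given) auto
qed

end

end

end

theorem proposition1:
  fixes M :: "'a measure" and S :: "'x measure"
    and Y1 :: "'a \<Rightarrow> real" and X1 :: "'a \<Rightarrow> 'x"
    and R1 R2 :: "'a \<Rightarrow> bool"
    and Y :: "'a \<Rightarrow> real option" and X :: "'a \<Rightarrow> 'x option"
    and \<zeta> :: "real option \<Rightarrow> real" and num den :: "'x option \<Rightarrow> real"
  assumes model: "permutation_model M S Y1 X1 R1 R2 Y X"
    and positivity: "positivity M S X1 R1 R2 Y"
    and integrable: "integrable M Y1"
    and \<zeta>: "regression_version (given M R1) Y (option_space borel) (\<lambda>\<omega>. of_bool (R2 \<omega>)) \<zeta>"
    and num: "regression_version (given M (\<lambda>\<omega>. R1 \<omega> \<and> R2 \<omega>)) X (option_space S)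
                (\<lambda>\<omega>. the (Y \<omega>) / \<zeta> (Y \<omega>)) num"
    and den: "regression_version (given M (\<lambda>\<omega>. R1 \<omega> \<and> R2 \<omega>)) X (option_space S)
                (\<lambda>\<omega>. 1 / \<zeta> (Y \<omega>)) den"
  shows "let \<psi> = \<integral>\<omega>. Y1 \<omega> \<partial>M;
             \<theta> = \<integral>\<omega>. Y1 \<omega> \<partial>(given M (\<lambda>\<omega>. \<not> R1 \<omega>))
         in \<psi> = \<P>(\<omega> in M. R1 \<omega>) * (\<integral>\<omega>. the (Y \<omega>) \<partial>(given M R1))
                + \<P>(\<omega> in M. \<not> R1 \<omega>) * \<theta>
            \<and> \<theta> = (\<integral>\<omega>. num (X \<omega>) / den (X \<omega>) \<partial>(given M (\<lambda>\<omega>. \<not> R1 \<omega> \<and> R2 \<omega>)))"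
proof -
  interpret permutation_model M S Y1 X1 R1 R2 Y X
    by (rule model)
  obtain p z where "missingness_probabilities M S Y1 X1 R1 R2 Y X p z"
    using missingness_probabilities_exist[OF positivity] by blast
  then interpret missingness_probabilities M S Y1 X1 R1 R2 Y X p z .
  show ?thesis
    unfolding Let_def
    using expectation_Y1_split[OF integrable]
      integral_given_not_R1_eq[OF \<zeta> integrable num den] by blast
qed

end
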